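(* Let $(W,\omega)$ be a real symplectic vector space of dimension $2n$. Given smooth matrices $\Sigma=\Sigma(\tau)\in\mathbb{R}^{n\times n}$ and $K=K(\tau)\in\mathbb{R}^{n\times n}$, $\tau\in I\subset\mathbb{R}$ ($I$ an open interval containing $0$), where $\Sigma$ is skew-symmetric and $K$ is diagonal with diagonal elements $k_1,\dots,k_n$ satisfying the functional relation $$\prod_{i=1}^{n}|k_i-\bar k|=1,\qquad \bar k=\frac1n\sum_{j=1}^n k_j ,$$ and given a symplectic basis $F_0=(\mathbf f_0,\overline{\mathbf f}_0)$ of $W$, there exists a unique Jacobi curve $\Gamma=\Gamma(\tau)$ in $\mathscr{L}(W)$ such that $\Gamma(0)=\mathrm{span}\{\mathbf f_0\}$ and the Cartan matrix related to $\Gamma$ is $$\mathbf C_\Gamma=\begin{pmatrix}\Sigma & K\\ \mathrm{Id} & \Sigma\end{pmatrix}.$$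
   Context: $(u|v):=\omega(u,v)$. $\mathscr{L}(W)$ is the Lagrangian Grassmannian; $\Lambda^{\pitchfork}$ is the set of Lagrangian subspaces transverse to $\Lambda$. A symplectic basis is a basis $(e_1,\dots,e_n,\bar e_1,\dots,\bar e_n)$ with $(e_i|e_j)=(\bar e_i|\bar e_j)=0$, $(e_i|\bar e_j)=\delta_{ij}$. Affine structure: for $\Gamma_0\in\Delta^{\pitchfork}$, each $\Gamma\in\Delta^{\pitchfork}$ is the graph of a unique linear map $\Gamma_0\to\Delta$, and this identifies $\Delta^{\pitchfork}$ with the vector space of linear maps $A\colon\Gamma_0\to\Delta$ with $(Au|v)+(u|Av)=0$; the affine structure so defined on $\Delta^{\pitchfork}$ is independent of the origin $\Gamma_0$. For a smooth curve $\Gamma(t)$ in $\mathscr{L}(W)$, $\dot\Gamma(t_0)$ is the quadratic form on $\Gamma(t_0)$ given by $\dot\Gamma(t_0)(v_0)=\omega(v_0,v'(t_0))$, where $v(t)\in\Gamma(t)$ is any smooth curve with $v(t_0)=v_0$. Here a Jacobi curve is a smooth curve with $\dot\Gamma(t)$ positive definite for all $t$. Derivative curve: for each $\tau$ there is a unique $\Delta_\tau\in\Gamma(\tau)^{\pitchfork}$ such that the curve $\Gamma$, viewed for $t$ near $\tau$ in the affine space $\Delta_\tau^{\pitchfork}$ (denoted $\Gamma_{\Delta_\tau}$), satisfies $\Gamma''_{\Delta_\tau}(\tau)=0$. Taking $\Gamma(\tau)$ as origin, $\Gamma'_{\Delta_\tau}(\tau)$ and $\Gamma'''_{\Delta_\tau}(\tau)$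 are linear maps $\Gamma(\tau)\to\Delta_\tau$, the first one invertible. The Ricci curvature operator is $R_\Gamma(\tau)=(\Gamma'_{\Delta_\tau}(\tau))^{-1}\circ\Gamma'''_{\Delta_\tau}(\tau)\colon\Gamma(\tau)\to\Gamma(\tau)$. The Cartan matrix is considered for Jacobi curves parametrized by geometric arc, i.e. with $\bigl|\det\bigl(R_\Gamma(\tau)-\tfrac1n\mathrm{tr}(R_\Gamma(\tau))\,\mathrm{Id}\bigr)\bigr|=1$ for all $\tau$. A symplectic Frenet frame along such a curve is a smooth family $F(\tau)=(\mathbf f(\tau),\overline{\mathbf f}(\tau))$ of symplectic bases of $W$ such that $\mathbf f(\tau)=(f_1,\dots,f_n)$ is a basis of $\Gamma(\tau)$ consisting of eigenvectors of $R_\Gamma(\tau)$, orthonormal with respect to $\dot\Gamma(\tau)$, and $\overline{\mathbf f}(\tau)$ is a basis of $\Delta_\tau$. The Cartan matrix related to $\Gamma$ is the matrix $\mathbf C_\Gamma(\tau)\in\mathbb{R}^{2n\times 2n}$ defined, for such a frame, by $\frac{d}{d\tau}(\mathbf f,\overline{\mathbf f})=(\mathbf f,\overline{\mathbf f})\,\mathbf C_\Gamma(\tau)$ (bases being written as row vectors).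
   Formalization: The Frenet frame giving the Cartan matrix is required to start at F_0 (with only Γ(0)=span f_0 uniqueness fails), and geometric arc is normalized by |det(½(R−(tr R/n)Id))|=1, since R=−2K makes the literal determinant 2^n. *)

theory Defs
  imports "HOL-Analysis.Analysis"
begin

definition nth_vderiv :: "nat \<Rightarrow> (real \<Rightarrow> 'b::real_normed_vector) \<Rightarrow> real \<Rightarrow> 'b" where
  "nth_vderiv k g = ((\<lambda>h t. vector_derivative h (at t)) ^^ k) g"

(* Intended for open J only, since the derivatives are two-sided. *)
definition smooth_curve_on :: "real set \<Rightarrow> (real \<Rightarrow> 'b::real_normed_vector) \<Rightarrow> bool" where
  "smooth_curve_on J g \<longleftrightarrow> (\<forall>k. \<forall>t\<in>J. nth_vderiv k g differentiable (at t))"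

definition symplectic_form :: "('a::euclidean_space \<Rightarrow> 'a \<Rightarrow> real) \<Rightarrow> bool" where
  "symplectic_form \<omega> \<longleftrightarrow>
     bilinear \<omega> \<and> (\<forall>v. \<omega> v v = 0) \<and> (\<forall>u. (\<forall>v. \<omega> u v = 0) \<longrightarrow> u = 0)"

definition basis_of :: "'a::euclidean_space set \<Rightarrow> ('m::finite \<Rightarrow> 'a) \<Rightarrow> bool" where
  "basis_of V b \<longleftrightarrow> inj b \<and> independent (range b) \<and> span (range b) = V"

(* The index type 'n + 'n is used for bases of W: Inl i indexes the vectors e_i and
   Inr i the vectors \bar e_i. *)
definition symplectic_basis ::
    "('a::euclidean_space \<Rightarrow> 'a \<Rightarrow> real) \<Rightarrow> ('n::finite + 'n \<Rightarrow> 'a) \<Rightarrow> bool" where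
  "symplectic_basis \<omega> F \<longleftrightarrow> basis_of UNIV F \<and>
     (\<forall>i j. \<omega> (F (Inl i)) (F (Inl j)) = 0 \<and> \<omega> (F (Inr i)) (F (Inr j)) = 0 \<and>
            \<omega> (F (Inl i)) (F (Inr j)) = (if i = j then 1 else 0))"

definition lagrangian :: "('a::euclidean_space \<Rightarrow> 'a \<Rightarrow> real) \<Rightarrow> 'a set \<Rightarrow> bool" where
  "lagrangian \<omega> L \<longleftrightarrow> subspace L \<and> (\<forall>u\<in>L. \<forall>v\<in>L. \<omega> u v = 0) \<and> 2 * dim L = DIM('a)"

definition transversals :: "('a::euclidean_space \<Rightarrow> 'a \<Rightarrow> real) \<Rightarrow> 'a set \<Rightarrow> 'a set set" where
  "transversals \<omega> D = {L. lagrangian \<omega> L \<and> L \<inter> D = {0}}"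

(* For G0 and G transverse to D, this is (on G0) the linear map A : G0 \<rightarrow> D whose graph
   {v + A v | v \<in> G0} is G, i.e. the affine coordinate of G with origin G0. *)
definition graph_map :: "'a::euclidean_space set \<Rightarrow> 'a set \<Rightarrow> 'a \<Rightarrow> 'a" where
  "graph_map D G v = (THE w. w \<in> D \<and> v + w \<in> G)"

(* Smoothness with respect to the atlas of the Lagrangian Grassmannian given by the affine
   charts; a curve of linear maps on G t0 is smooth iff it is so pointwise. *)
definition smooth_lagrangian_curve ::
    "('a::euclidean_space \<Rightarrow> 'a \<Rightarrow> real) \<Rightarrow> real set \<Rightarrow> (real \<Rightarrow> 'a set) \<Rightarrow> bool" where
  "smooth_lagrangian_curve \<omega> I G \<longleftrightarrow>
     (\<forall>t\<in>I. lagrangian \<omega> (G t)) \<and>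
     (\<forall>t0\<in>I. \<exists>D J. lagrangian \<omega> D \<and> open J \<and> t0 \<in> J \<and> J \<subseteq> I \<and>
        (\<forall>t\<in>J. G t \<in> transversals \<omega> D) \<and>
        (\<forall>v\<in>G t0. smooth_curve_on J (\<lambda>t. graph_map D (G t) v)))"

definition velocity_form ::
    "('a::euclidean_space \<Rightarrow> 'a \<Rightarrow> real) \<Rightarrow> real set \<Rightarrow> (real \<Rightarrow> 'a set) \<Rightarrow> real \<Rightarrow> 'a \<Rightarrow> real" where
  "velocity_form \<omega> I G t0 v0 =
     (THE q. \<exists>v. smooth_curve_on I v \<and> (\<forall>t\<in>I. v t \<in> G t) \<and> v t0 = v0 \<and>
                 q = \<omega> v0 (vector_derivative v (at t0)))"

definition jacobi_curve ::
    "('a::euclidean_space \<Rightarrow> 'a \<Rightarrow> real) \<Rightarrow> real set \<Rightarrow> (real \<Rightarrow> 'a set) \<Rightarrow> bool" where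
  "jacobi_curve \<omega> I G \<longleftrightarrow> smooth_lagrangian_curve \<omega> I G \<and>
     (\<forall>t\<in>I. \<forall>v\<in>G t. v \<noteq> 0 \<longrightarrow> velocity_form \<omega> I G t v > 0)"

definition polar_form :: "('a::euclidean_space \<Rightarrow> real) \<Rightarrow> 'a \<Rightarrow> 'a \<Rightarrow> real" where
  "polar_form q u v = (q (u + v) - q u - q v) / 2"

(* k-th derivative at \<tau> of G in the affine space of Lagrangian subspaces transverse to D,
   with origin G \<tau>: a linear map G \<tau> \<rightarrow> D (for k \<ge> 1). *)
definition affine_deriv ::
    "nat \<Rightarrow> 'a::euclidean_space set \<Rightarrow> (real \<Rightarrow> 'a set) \<Rightarrow> real \<Rightarrow> 'a \<Rightarrow> 'a" where
  "affine_deriv k D G \<tau> v = nth_vderiv k (\<lambda>t. graph_map D (G t) v) \<tau>"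

definition derivative_curve ::
    "('a::euclidean_space \<Rightarrow> 'a \<Rightarrow> real) \<Rightarrow> (real \<Rightarrow> 'a set) \<Rightarrow> real \<Rightarrow> 'a set" where
  "derivative_curve \<omega> G \<tau> =
     (THE D. D \<in> transversals \<omega> (G \<tau>) \<and> (\<forall>v\<in>G \<tau>. affine_deriv 2 D G \<tau> v = 0))"

definition ricci ::
    "('a::euclidean_space \<Rightarrow> 'a \<Rightarrow> real) \<Rightarrow> (real \<Rightarrow> 'a set) \<Rightarrow> real \<Rightarrow> 'a \<Rightarrow> 'a" where
  "ricci \<omega> G \<tau> v =
     (let D = derivative_curve \<omega> G \<tau>
      in inv_into (G \<tau>) (affine_deriv 1 D G \<tau>) (affine_deriv 3 D G \<tau> v))"

definition matrix_wrt :: "('n::finite \<Rightarrow> 'a::euclidean_space) \<Rightarrow> ('a \<Rightarrow> 'a) \<Rightarrow> real^'n^'n" where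
  "matrix_wrt b T = (\<chi> i j. representation (range b) (T (b j)) (b i))"

(* The type argument fixes n = CARD('n); the condition does not depend on the basis b.

   Normalization.  For a symplectic Frenet frame with structure equation
     f' = f \<Sigma> + \bar f,   \bar f' = f K + \bar f \<Sigma>
   the curve has, in the affine space at its derivative subspace, the coordinate
   t Id - (t^3/3) K + O(t^4) when \<Sigma> = 0, and in general ricci has matrix -2 K in the basis f.
   Hence the functional relation \<Prod>|k_i - \bar k| = 1 says precisely that the trace-free part of
   (1/2) ricci (half the operator, i.e. the matrix Schwarzian of the curve) has determinant
   of modulus 1.  The factor 1/2 is therefore needed here: with ricci itself the modulus
   would be 2^n. *)
definition geometric_arc ::
    "'n::finite itself \<Rightarrow> ('a::euclidean_space \<Rightarrow> 'a \<Rightarrow> real) \<Rightarrow> real set \<Rightarrow> (real \<Rightarrow> 'a set) \<Rightarrow> bool" where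
  "geometric_arc _ \<omega> I G \<longleftrightarrow>
     (\<forall>\<tau>\<in>I. \<forall>b :: 'n \<Rightarrow> 'a. basis_of (G \<tau>) b \<longrightarrow>
        (let R = matrix_wrt b (ricci \<omega> G \<tau>)
         in \<bar>det ((1/2) *\<^sub>R (R - mat (trace R / real CARD('n))))\<bar> = 1))"

definition frenet_frame ::
    "('a::euclidean_space \<Rightarrow> 'a \<Rightarrow> real) \<Rightarrow> real set \<Rightarrow> (real \<Rightarrow> 'a set) \<Rightarrow>
     (real \<Rightarrow> 'n::finite + 'n \<Rightarrow> 'a) \<Rightarrow> bool" where
  "frenet_frame \<omega> I G F \<longleftrightarrow>
     (\<forall>i. smooth_curve_on I (\<lambda>\<tau>. F \<tau> i)) \<and>
     (\<forall>\<tau>\<in>I. symplectic_basis \<omega> (F \<tau>) \<and>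
        basis_of (G \<tau>) (\<lambda>i. F \<tau> (Inl i)) \<and>
        (\<forall>i. \<exists>c. ricci \<omega> G \<tau> (F \<tau> (Inl i)) = c *\<^sub>R F \<tau> (Inl i)) \<and>
        (\<forall>i j. polar_form (velocity_form \<omega> I G \<tau>) (F \<tau> (Inl i)) (F \<tau> (Inl j)) =
               (if i = j then 1 else 0)) \<and>
        basis_of (derivative_curve \<omega> G \<tau>) (\<lambda>i. F \<tau> (Inr i)))"

definition frame_cartan_matrix ::
    "real set \<Rightarrow> (real \<Rightarrow> 'm::finite \<Rightarrow> 'a::euclidean_space) \<Rightarrow> (real \<Rightarrow> real^'m^'m) \<Rightarrow> bool" where
  "frame_cartan_matrix I F C \<longleftrightarrow>
     (\<forall>\<tau>\<in>I. \<forall>j. ((\<lambda>t. F t j) has_vector_derivative (\<Sum>i\<in>UNIV. (C \<tau> $ i $ j) *\<^sub>R F \<tau> i)) (at \<tau>))"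

(* The Cartan matrix depends on the Frenet frame; F0 is the value at 0 of the frame used. *)
definition has_cartan_matrix ::
    "('a::euclidean_space \<Rightarrow> 'a \<Rightarrow> real) \<Rightarrow> real set \<Rightarrow> ('n::finite + 'n \<Rightarrow> 'a) \<Rightarrow>
     (real \<Rightarrow> 'a set) \<Rightarrow> (real \<Rightarrow> real^('n + 'n)^('n + 'n)) \<Rightarrow> bool" where
  "has_cartan_matrix \<omega> I F0 G C \<longleftrightarrow>
     geometric_arc TYPE('n) \<omega> I G \<and>
     (\<exists>F. frenet_frame \<omega> I G F \<and> F 0 = F0 \<and> frame_cartan_matrix I F C)"

definition block_matrix ::
    "real^'n^'n \<Rightarrow> real^'n^'n \<Rightarrow> real^'n^'n \<Rightarrow> real^'n^'n \<Rightarrow> real^('n::finite + 'n)^('n + 'n)" where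
  "block_matrix A B C D =
     (\<chi> i j. case i of
        Inl i' \<Rightarrow> (case j of Inl j' \<Rightarrow> A $ i' $ j' | Inr j' \<Rightarrow> B $ i' $ j')
      | Inr i' \<Rightarrow> (case j of Inl j' \<Rightarrow> C $ i' $ j' | Inr j' \<Rightarrow> D $ i' $ j'))"

end

theory Submission
  imports Defs
begin

text \<open>The frame equation is a linear ODE with coefficient matrix in the symplectic Lie algebra, so it
  has a unique global solution starting at \<open>F0\<close>, and this solution consists of symplectic bases; the
  curve must be the span of its first half.  To see that this curve has the prescribed invariants, fix
  \<open>\<tau>\<close> and write the frame at time \<open>t\<close> in the frame at time \<open>\<tau>\<close>, as a block matrix with block
  columns \<open>(A, B)\<close> and \<open>(P, Q)\<close>.  In the chart given by the second half of the frame at \<open>\<tau>\<close> the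
  curve is \<open>M = B A\<^sup>-\<^sup>1\<close>, with \<open>M' = N A\<^sup>-\<^sup>1\<close> and \<open>M'' = - 2 N A\<^sup>-\<^sup>1 P A\<^sup>-\<^sup>1\<close> for \<open>N = Q - M P\<close>.
  At \<open>\<tau>\<close> this gives \<open>M' = 1\<close>, \<open>M'' = 0\<close> and \<open>M''' = - 2 K\<close>.  In a chart sheared by \<open>Z\<close> the same
  computation gives \<open>M'' = 2 Z\<close>, so the derivative subspace is unique.\<close>

subsection \<open>Smooth curves\<close>

text \<open>The coefficient matrix is in the symplectic Lie algebra because \<open>S\<close> is skew
  while \<open>K\<close> and the identity block are symmetric. The constants come from the base
  time, where \<open>A = Q = 1\<close>, \<open>B = 0\<close> and \<open>P = - Z\<close>: the formula
  for \<open>M''\<close> then yields \<open>2 Z\<close>, and for \<open>Z = 0\<close> the matrix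
  \<open>P\<close> vanishes with derivative \<open>K\<close>, which leaves \<open>- 2 K\<close> as
  third derivative. Two features of the definitions shape the proof. \<open>graph_map\<close>,
  \<open>velocity_form\<close> and \<open>derivative_curve\<close> are definite descriptions, so no
  value can be computed before its uniqueness is shown. Iterated derivatives depend on a whole
  neighbourhood, so the chart formulas must hold on the open set where \<open>A\<close> is
  invertible and not just at \<open>\<tau>\<close>. Uniqueness of the curve is the short half: the
  Cartan matrix is taken along a frame with prescribed value \<open>F0\<close> at 0, so the frames
  of two candidate curves solve the same initial value problem.\<close>

primrec Ck_on :: "nat \<Rightarrow> real set \<Rightarrow> (real \<Rightarrow> 'b::real_normed_vector) \<Rightarrow> bool" where
  "Ck_on 0 J g = True"
| "Ck_on (Suc k) J g =
     (\<exists>g'. (\<forall>t\<in>J. (g has_vector_derivative g' t) (at t)) \<and> Ck_on k J g')"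

lemma Ck_on_SucI:
  "(\<And>t. t \<in> J \<Longrightarrow> (g has_vector_derivative g' t) (at t)) \<Longrightarrow> Ck_on k J g' \<Longrightarrow> Ck_on (Suc k) J g"
  by auto

lemma nth_vderiv_0 [simp]: "nth_vderiv 0 g = g"
  by (simp add: nth_vderiv_def)

text \<open>Peels off the derivative that is taken first, so that inductions on the order run over
  all functions instead of over points.\<close>

lemma nth_vderiv_Suc: "nth_vderiv (Suc k) g = nth_vderiv k (\<lambda>t. vector_derivative g (at t))"
  unfolding nth_vderiv_def by (simp only: funpow_Suc_right o_apply)

lemma vector_derivative_cong_open:
  assumes "open J" "t \<in> J" "\<And>s. s \<in> J \<Longrightarrow> f s = g s"
  shows "vector_derivative f (at t) = vector_derivative g (at t)"
proof -
  have "\<forall>\<^sub>F x in nhds t. f x = g x"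
    using assms eventually_nhds by blast
  then show ?thesis
    by (intro vector_derivative_cong_eq) (auto intro: eventually_nhds_x_imp_x)
qed

text \<open>Equality on an open set passes to the derivatives on that same set, and so to every
  order. This transfers derivatives from explicit formulas to \<open>graph_map\<close>, whose value
  is known only on a chart domain.\<close>

lemma nth_vderiv_cong_open:
  assumes "open J" "t \<in> J" "\<And>s. s \<in> J \<Longrightarrow> f s = g s"
  shows "nth_vderiv k f t = nth_vderiv k g t"
  using assms(2,3)
proof (induction k arbitrary: f g t)
  case 0
  then show ?case by simp
next
  case (Suc k)
  show ?case
    unfolding nth_vderiv_Suc
    by (rule Suc.IH[OF Suc.prems(1)]) (blast intro: vector_derivative_cong_open assms(1) Suc.prems(2))
qed

lemma nth_vderiv_Suc_open:
  assumes "open J" "t \<in> J" "\<And>s. s \<in> J \<Longrightarrow> (g has_vector_derivative g' s) (at s)"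
  shows "nth_vderiv (Suc k) g t = nth_vderiv k g' t"
  unfolding nth_vderiv_Suc
  by (rule nth_vderiv_cong_open[OF assms(1,2)]) (simp add: assms(3) vector_derivative_at)

lemma differentiable_cong_open:
  assumes "open J" "t \<in> J" "\<And>s. s \<in> J \<Longrightarrow> f s = g s" "f differentiable (at t)"
  shows "g differentiable (at t)"
  using assms has_derivative_transform_within_open[of f _ t UNIV J g]
  unfolding differentiable_def by auto

lemma smooth_curve_on_cong:
  assumes "open J" "\<And>s. s \<in> J \<Longrightarrow> f s = g s" "smooth_curve_on J f"
  shows "smooth_curve_on J g"
  unfolding smooth_curve_on_def
proof (intro allI ballI)
  fix k t assume t: "t \<in> J"
  have "nth_vderiv k f differentiable (at t)" using assms(3) t by (simp add: smooth_curve_on_def)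
  then show "nth_vderiv k g differentiable (at t)"
    by (rule differentiable_cong_open[OF assms(1) t, rotated])
       (rule nth_vderiv_cong_open[OF assms(1) _ assms(2)])
qed

text \<open>\<open>Ck_on k\<close> asks for \<open>k\<close> successive derivatives with no
  continuity of the last one, so it is slightly weaker than the usual class; over all
  \<open>k\<close> together the two agree. Its explicit derivative witnesses turn the closure
  properties into inductions on \<open>k\<close>.\<close>

lemma Ck_on_iff:
  assumes "open J"
  shows "Ck_on k J g \<longleftrightarrow> (\<forall>i<k. \<forall>t\<in>J. nth_vderiv i g differentiable (at t))"
proof (induction k arbitrary: g)
  case 0
  then show ?case by simp
next
  case (Suc k)
  show ?case
  proof
    assume "Ck_on (Suc k) J g"
    then obtain g' where g': "\<And>t. t \<in> J \<Longrightarrow> (g has_vector_derivative g' t) (at t)" "Ck_on k J g'"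
      by auto
    have "nth_vderiv i g differentiable (at t)" if "i < Suc k" "t \<in> J" for i t
    proof (cases i)
      case 0
      then show ?thesis
        using g'(1)[OF that(2)] by (simp add: differentiableI_vector)
    next
      case (Suc j)
      have "nth_vderiv j g' differentiable (at t)"
        using Suc.IH g'(2) that Suc by auto
      then show ?thesis
        unfolding Suc
        by (rule differentiable_cong_open[OF assms that(2), rotated])
           (simp add: nth_vderiv_Suc_open[OF assms _ g'(1)])
    qed
    then show "\<forall>i<Suc k. \<forall>t\<in>J. nth_vderiv i g differentiable (at t)" by blast
  next
    assume *: "\<forall>i<Suc k. \<forall>t\<in>J. nth_vderiv i g differentiable (at t)"
    let ?g' = "\<lambda>t. vector_derivative g (at t)"
    have "\<forall>t\<in>J. (g has_vector_derivative ?g' t) (at t)"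
      using * by (metis nth_vderiv_0 vector_derivative_works zero_less_Suc)
    moreover have "Ck_on k J ?g'"
      unfolding Suc.IH using * by (metis Suc_mono nth_vderiv_Suc)
    ultimately show "Ck_on (Suc k) J g" by auto
  qed
qed

lemma smooth_curve_on_iff_Ck_on:
  "open J \<Longrightarrow> smooth_curve_on J g \<longleftrightarrow> (\<forall>k. Ck_on k J g)"
  by (auto simp: smooth_curve_on_def Ck_on_iff)

lemma Ck_on_mono:
  assumes "Ck_on (Suc k) J g"
  shows "Ck_on k J g"
  using assms
proof (induction k arbitrary: g)
  case (Suc k)
  then show ?case by (metis Ck_on.simps(2))
qed simp

lemma Ck_on_const: "Ck_on k J (\<lambda>t. c)"
proof (induction k arbitrary: c)
  case (Suc k)
  then show ?case by (auto intro!: exI[of _ "\<lambda>t. 0"])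
qed simp

lemma Ck_on_bounded_linear:
  assumes "bounded_linear h" "Ck_on k J g"
  shows "Ck_on k J (\<lambda>t. h (g t))"
  using assms(2)
proof (induction k arbitrary: g)
  case (Suc k)
  then obtain g' where g': "\<forall>t\<in>J. (g has_vector_derivative g' t) (at t)" "Ck_on k J g'"
    by auto
  then show ?case
    using Suc.IH[OF g'(2)] bounded_linear.has_vector_derivative[OF assms(1)] by fastforce
qed simp

lemma Ck_on_add:
  assumes "Ck_on k J f" "Ck_on k J g"
  shows "Ck_on k J (\<lambda>t. f t + g t)"
  using assms
proof (induction k arbitrary: f g)
  case (Suc k)
  then obtain f' g' where "\<forall>t\<in>J. (f has_vector_derivative f' t) (at t)" "Ck_on k J f'"
     "\<forall>t\<in>J. (g has_vector_derivative g' t) (at t)" "Ck_on k J g'"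
    by auto
  then show ?case
    using Suc.IH[of f' g'] by (auto intro!: exI[of _ "\<lambda>t. f' t + g' t"] has_vector_derivative_add)
qed simp

lemma Ck_on_sum:
  assumes "\<And>i. i \<in> A \<Longrightarrow> Ck_on k J (f i)"
  shows "Ck_on k J (\<lambda>t. \<Sum>i\<in>A. f i t)"
  using assms by (induction A rule: infinite_finite_induct) (auto intro: Ck_on_const Ck_on_add)

lemma Ck_on_bounded_bilinear:
  assumes h: "bounded_bilinear h" and "Ck_on k J f" "Ck_on k J g"
  shows "Ck_on k J (\<lambda>t. h (f t) (g t))"
  using assms(2,3)
proof (induction k arbitrary: f g)
  case (Suc k)
  then obtain f' g' where d: "\<And>t. t\<in>J \<Longrightarrow> (f has_vector_derivative f' t) (at t)" "Ck_on k J f'"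
     "\<And>t. t\<in>J \<Longrightarrow> (g has_vector_derivative g' t) (at t)" "Ck_on k J g'"
    unfolding Ck_on.simps by blast
  \<comment> \<open>The product rule mixes each factor with the derivative of the other, so the
    undifferentiated factors must be lowered to order \<open>k\<close> as well.\<close>
  have "Ck_on k J f" "Ck_on k J g" using Suc.prems by (blast dest: Ck_on_mono)+
  then have "Ck_on k J (\<lambda>t. h (f t) (g' t) + h (f' t) (g t))"
    by (intro Ck_on_add Suc.IH d)
  then show ?case
    by (rule Ck_on_SucI[rotated]) (rule bounded_bilinear.has_vector_derivative[OF h d(1,3)])
qed simp

lemma smooth_imp_Ck_on: "open J \<Longrightarrow> smooth_curve_on J g \<Longrightarrow> Ck_on k J g"
  by (simp add: smooth_curve_on_iff_Ck_on)

lemma smooth_imp_continuous_on: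
  assumes "smooth_curve_on J g"
  shows "continuous_on J g"
  using assms unfolding smooth_curve_on_def
  by (metis continuous_at_imp_continuous_on differentiable_imp_continuous_within nth_vderiv_0)

text \<open>Bootstrapping: if \<open>X\<close> has \<open>k\<close> derivatives then so does the
  right-hand side, which is the derivative of \<open>X\<close>.\<close>

lemma smooth_linear_ode:
  assumes h: "bounded_bilinear h" and J: "open J" and C: "smooth_curve_on J C"
    and X: "\<And>t. t \<in> J \<Longrightarrow> (X has_vector_derivative h (X t) (C t)) (at t)"
  shows "smooth_curve_on J X"
proof -
  have "Ck_on k J X" for k
  proof (induction k)
    case (Suc k)
    have "Ck_on k J (\<lambda>t. h (X t) (C t))"
      by (rule Ck_on_bounded_bilinear[OF h Suc.IH smooth_imp_Ck_on[OF J C]])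
    then show ?case by (rule Ck_on_SucI[rotated]) (rule X)
  qed simp
  then show ?thesis by (simp add: smooth_curve_on_iff_Ck_on J)
qed

subsection \<open>Linear ordinary differential equations\<close>

text \<open>Extended real endpoints include the unbounded intervals and give the form in which
  \<open>einterval_antiderivative\<close> applies.\<close>

lemma open_interval_eq_einterval:
  fixes I :: "real set"
  assumes "open I" "is_interval I"
  shows "I = einterval (INF x\<in>I. ereal x) (SUP x\<in>I. ereal x)"
proof (intro equalityI subsetI)
  fix x assume x: "x \<in> I"
  obtain e where e: "e > 0" "ball x e \<subseteq> I"
    using \<open>open I\<close> x open_contains_ball by blast
  have m: "x - e/2 \<in> I" "x + e/2 \<in> I"
    using e by (auto simp: subset_iff dist_real_def)
  have "(INF x\<in>I. ereal x) \<le> ereal (x - e/2)" using m(1) by (rule INF_lower)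
  moreover have "ereal (x + e/2) \<le> (SUP x\<in>I. ereal x)" using m(2) by (rule SUP_upper)
  moreover have "ereal (x - e/2) < ereal x" "ereal x < ereal (x + e/2)" using e by auto
  ultimately show "x \<in> einterval (INF x\<in>I. ereal x) (SUP x\<in>I. ereal x)"
    unfolding einterval_iff by (meson le_less_trans less_le_trans)
next
  fix x assume "x \<in> einterval (INF x\<in>I. ereal x) (SUP x\<in>I. ereal x)"
  then obtain a b where "a \<in> I" "b \<in> I" "a < x" "x < b"
    unfolding einterval_iff INF_less_iff less_SUP_iff by auto
  then show "x \<in> I" using assms(2) unfolding is_interval_1 by (meson less_imp_le)
qed

lemma antiderivative_on_open_interval:
  fixes I :: "real set" and f :: "real \<Rightarrow> 'b::euclidean_space"
  assumes "open I" "is_interval I" "a \<in> I" "continuous_on I f"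
  obtains F where "F a = 0" "\<And>x. x \<in> I \<Longrightarrow> (F has_vector_derivative f x) (at x)"
proof -
  let ?l = "INF x\<in>I. ereal x" and ?u = "SUP x\<in>I. ereal x"
  have I: "x \<in> I \<longleftrightarrow> ?l < ereal x \<and> ereal x < ?u" for x
    using open_interval_eq_einterval[OF assms(1,2)] einterval_iff by blast
  have "?l < ?u" using I[of a] \<open>a \<in> I\<close> by (meson less_trans)
  then obtain F where F: "\<And>x. x \<in> I \<Longrightarrow> (F has_vector_derivative f x) (at x)"
    using einterval_antiderivative[of ?l ?u f] I assms(1,4)
    by (metis continuous_on_eq_continuous_at)
  show ?thesis
  proof (rule that[of "\<lambda>x. F x - F a"])
    show "((\<lambda>x. F x - F a) has_vector_derivative f x) (at x)" if "x \<in> I" for x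
      using has_vector_derivative_diff[OF F[OF that] has_vector_derivative_const[of "F a"]] by simp
  qed simp
qed

section \<open>Factorial bounds, uniqueness and existence for linear equations\<close>

lemma norm_le_power_of_derivative_le_pos:
  fixes f :: "real \<Rightarrow> 'b::real_normed_vector"
  assumes "0 \<le> t" "f 0 = 0"
    and f': "\<And>s. s \<in> {0..t} \<Longrightarrow> (f has_vector_derivative f' s) (at s)"
    and b: "\<And>s. s \<in> {0..t} \<Longrightarrow> norm (f' s) \<le> A * s ^ k"
  shows "norm (f t) \<le> A * t ^ Suc k / real (Suc k)"
proof (cases "t = 0")
  case False
  have d: "((\<lambda>s. A * s ^ Suc k / real (Suc k)) has_real_derivative A * s ^ k) (at s)" for s
    using DERIV_cmult[OF DERIV_pow[of "Suc k" s], of "A / real (Suc k)"] by simp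
  have "norm (f t - f 0) \<le> A * t ^ Suc k / real (Suc k) - A * 0 ^ Suc k / real (Suc k)"
  proof (rule differentiable_bound_general[where f' = f'])
    show "continuous_on {0..t} f"
      by (meson continuous_at_imp_continuous_on f' has_vector_derivative_continuous)
    show "continuous_on {0..t} (\<lambda>s. A * s ^ Suc k / real (Suc k))"
      by (intro continuous_intros) auto
    show "0 < t" using assms False by simp
  qed (use assms d in \<open>auto simp: has_real_derivative_iff_has_vector_derivative simp del: power_Suc\<close>)
  then show ?thesis using assms by simp
qed (use assms in simp)

text \<open>Times before 0 are reduced to positive ones by the reflection of \<open>s\<close> to
  \<open>- s\<close>.\<close>

lemma norm_le_power_of_derivative_le:
  fixes f :: "real \<Rightarrow> 'b::real_normed_vector"
  assumes "f 0 = 0"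
    and f': "\<And>s. s \<in> closed_segment 0 t \<Longrightarrow> (f has_vector_derivative f' s) (at s)"
    and b: "\<And>s. s \<in> closed_segment 0 t \<Longrightarrow> norm (f' s) \<le> A * \<bar>s\<bar> ^ k"
  shows "norm (f t) \<le> A * \<bar>t\<bar> ^ Suc k / real (Suc k)"
proof (cases "0 \<le> t")
  case True
  then show ?thesis
    using norm_le_power_of_derivative_le_pos[of t f f' A k] assms
    by (simp add: closed_segment_eq_real_ivl)
next
  case False
  let ?g = "\<lambda>s. f (- s)"
  have "norm (?g (- t)) \<le> A * (- t) ^ Suc k / real (Suc k)"
  proof (rule norm_le_power_of_derivative_le_pos)
    fix s assume s: "s \<in> {0..-t}"
    then have m: "- s \<in> closed_segment 0 t" using False by (auto simp: closed_segment_eq_real_ivl)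
    show "(?g has_vector_derivative - f' (- s)) (at s)"
      using vector_diff_chain_at[of uminus "-1" s f "f' (- s)"] f'[OF m]
        has_vector_derivative_minus[OF has_vector_derivative_id, of "at s"]
      by (simp add: o_def)
    show "norm (- f' (- s)) \<le> A * s ^ k" using b[OF m] s by simp
  qed (use False assms in auto)
  then show ?thesis using False by (simp del: power_Suc)
qed

text \<open>Each step from \<open>Y k\<close> to \<open>Y (Suc k)\<close> integrates from 0 and
  costs a factor \<open>M\<close>, which builds up the terms of an exponential series. For existence
  the \<open>Y k\<close> are successive Picard terms; for uniqueness all of them are one and the
  same solution.\<close>

lemma picard_bound:
  fixes Y :: "nat \<Rightarrow> real \<Rightarrow> 'b::real_normed_vector"
  assumes T: "0 \<in> T" "is_interval T"
    and Y0: "\<And>s. s \<in> T \<Longrightarrow> norm (Y 0 s) \<le> A"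
    and Yz: "\<And>k. Y (Suc k) 0 = 0"
    and Y': "\<And>k s. s \<in> T \<Longrightarrow> (Y (Suc k) has_vector_derivative Y' k s) (at s)"
    and b: "\<And>k s. s \<in> T \<Longrightarrow> norm (Y' k s) \<le> M * norm (Y k s)"
    and "0 \<le> M" "t \<in> T"
  shows "norm (Y k t) \<le> A * (M * \<bar>t\<bar>) ^ k / fact k"
  using \<open>t \<in> T\<close>
proof (induction k arbitrary: t)
  case 0
  then show ?case using Y0 by simp
next
  case (Suc k)
  have seg: "closed_segment 0 t \<subseteq> T"
    using T Suc.prems by (simp add: closed_segment_subset is_interval_convex)
  have "norm (Y (Suc k) t) \<le> (A * M ^ Suc k / fact k) * \<bar>t\<bar> ^ Suc k / real (Suc k)"
  proof (rule norm_le_power_of_derivative_le[where f = "Y (Suc k)", OF Yz])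
    fix s assume s: "s \<in> closed_segment 0 t"
    then have "s \<in> T" using seg by blast
    then show "(Y (Suc k) has_vector_derivative Y' k s) (at s)" by (rule Y')
    have "norm (Y' k s) \<le> M * norm (Y k s)" using b \<open>s \<in> T\<close> by blast
    also have "\<dots> \<le> M * (A * (M * \<bar>s\<bar>) ^ k / fact k)"
      using Suc.IH \<open>s \<in> T\<close> \<open>0 \<le> M\<close> by (intro mult_left_mono) auto
    finally show "norm (Y' k s) \<le> (A * M ^ Suc k / fact k) * \<bar>s\<bar> ^ k"
      by (simp add: power_mult_distrib mult_ac)
  qed
  also have "\<dots> = A * (M * \<bar>t\<bar>) ^ Suc k / fact (Suc k)"
    by (simp add: power_mult_distrib mult_ac)
  finally show ?case .
qed

lemma bounded_bilinear_bound_on_compact: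
  fixes h :: "'b::real_normed_vector \<Rightarrow> 'c::real_normed_vector \<Rightarrow> 'b"
  assumes h: "bounded_bilinear h" and T: "compact T" "continuous_on T C"
  obtains M where "0 \<le> M" "\<And>x s. s \<in> T \<Longrightarrow> norm (h x (C s)) \<le> M * norm x"
proof -
  obtain B where B: "\<And>x y. norm (h x y) \<le> norm x * norm y * B" "B > 0"
    using bounded_bilinear.pos_bounded[OF h] by blast
  have "bounded (C ` T)" using T by (simp add: compact_continuous_image compact_imp_bounded)
  then obtain c where c: "c > 0" "\<And>s. s \<in> T \<Longrightarrow> norm (C s) \<le> c"
    unfolding bounded_pos by auto
  show ?thesis
  proof (rule that[of "c * B"])
    show "0 \<le> c * B" using B c by simp
    fix x s assume "s \<in> T"
    have "norm (h x (C s)) \<le> norm x * norm (C s) * B" by (rule B)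
    also have "\<dots> \<le> norm x * c * B"
      using c(2)[OF \<open>s \<in> T\<close>] B(2) by (intro mult_right_mono mult_left_mono) auto
    finally show "norm (h x (C s)) \<le> c * B * norm x" by (simp add: mult_ac)
  qed
qed

text \<open>A solution vanishing at 0 can be fed into \<open>picard_bound\<close> as the constant
  sequence, so its norm lies below every term of a null sequence.\<close>

lemma linear_ode_unique_zero:
  fixes h :: "'b::real_normed_vector \<Rightarrow> 'c::real_normed_vector \<Rightarrow> 'b"
  assumes h: "bounded_bilinear h" and I: "is_interval I" "0 \<in> I" and C: "continuous_on I C"
    and X: "\<And>t. t \<in> I \<Longrightarrow> (X has_vector_derivative h (X t) (C t)) (at t)" and "X 0 = 0"
    and "t \<in> I"
  shows "X t = 0"
proof -
  let ?T = "closed_segment 0 t"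
  have T: "?T \<subseteq> I" using I \<open>t \<in> I\<close> by (simp add: closed_segment_subset is_interval_convex)
  obtain M where M: "0 \<le> M" "\<And>x s. s \<in> ?T \<Longrightarrow> norm (h x (C s)) \<le> M * norm x"
    using bounded_bilinear_bound_on_compact[OF h compact_segment continuous_on_subset[OF C T]] by blast
  have "continuous_on ?T X"
    using T X by (meson continuous_at_imp_continuous_on has_vector_derivative_continuous subsetD)
  then have "bounded (X ` ?T)" by (simp add: compact_continuous_image compact_imp_bounded)
  then obtain A where A: "\<And>s. s \<in> ?T \<Longrightarrow> norm (X s) \<le> A"
    unfolding bounded_iff by auto
  have b: "norm (X t) \<le> A * (M * \<bar>t\<bar>) ^ k / fact k" for k
  proof (rule picard_bound[of ?T "\<lambda>_. X" A "\<lambda>_ s. h (X s) (C s)" M])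
    show "is_interval ?T" by (simp add: is_interval_convex_1)
    show "(X has_vector_derivative h (X s) (C s)) (at s)" if "s \<in> ?T" for s
      using X T that by blast
  qed (use A M \<open>X 0 = 0\<close> in auto)
  have "(\<lambda>k. (M * \<bar>t\<bar>) ^ k /\<^sub>R fact k) \<longlonglongrightarrow> 0"
    by (rule summable_LIMSEQ_zero[OF summable_exp_generic])
  then have "(\<lambda>k. A * ((M * \<bar>t\<bar>) ^ k /\<^sub>R fact k)) \<longlonglongrightarrow> A * 0"
    by (rule tendsto_mult_left)
  then have "(\<lambda>k. A * (M * \<bar>t\<bar>) ^ k / fact k) \<longlonglongrightarrow> 0"
    by (simp add: divide_inverse mult_ac)
  then have "norm (X t) \<le> 0"
    by (rule Lim_bounded2) (use b in auto)
  then show ?thesis by simp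
qed

text \<open>The solution is the series of iterated integrals of \<open>x0\<close>. Linearity makes
  the factorial bounds hold on every compact part of \<open>I\<close>, so the solution lives on all
  of \<open>I\<close>.\<close>

lemma linear_ode_exists:
  fixes h :: "'b::euclidean_space \<Rightarrow> 'c::real_normed_vector \<Rightarrow> 'b"
  assumes h: "bounded_bilinear h" and I: "open I" "is_interval I" "0 \<in> I" and C: "continuous_on I C"
  obtains X where "X 0 = x0" "\<And>t. t \<in> I \<Longrightarrow> (X has_vector_derivative h (X t) (C t)) (at t)"
proof -
  \<comment> \<open>Dependent choice fixes the first element only through a property, so the clause
    for \<open>k = 0\<close> pins it to the constant \<open>x0\<close>. Continuity is carried along
    because the next antiderivative needs a continuous integrand.\<close>
  have "\<exists>Y. \<forall>k. (continuous_on I (Y k) \<and> (k = 0 \<longrightarrow> Y k = (\<lambda>_. x0))) \<and>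
          (Y (Suc k) 0 = 0 \<and> (\<forall>t\<in>I. (Y (Suc k) has_vector_derivative h (Y k t) (C t)) (at t)))"
  proof (rule dependent_nat_choice)
    show "\<exists>x. continuous_on I x \<and> ((0::nat) = 0 \<longrightarrow> x = (\<lambda>_. x0))" by auto
    fix y and k :: nat
    assume y: "continuous_on I y \<and> (k = 0 \<longrightarrow> y = (\<lambda>_. x0))"
    have "continuous_on I (\<lambda>t. h (y t) (C t))"
      using y by (intro bounded_bilinear.continuous_on[OF h] C) simp
    then obtain F where F: "F 0 = 0" "\<And>x. x \<in> I \<Longrightarrow> (F has_vector_derivative h (y x) (C x)) (at x)"
      using antiderivative_on_open_interval[OF I] by blast
    moreover have "continuous_on I F"
      using F by (meson continuous_at_imp_continuous_on has_vector_derivative_continuous)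
    ultimately show "\<exists>z. (continuous_on I z \<and> (Suc k = 0 \<longrightarrow> z = (\<lambda>_. x0))) \<and>
        z 0 = 0 \<and> (\<forall>t\<in>I. (z has_vector_derivative h (y t) (C t)) (at t))" by auto
  qed
  then obtain Y where Y0: "Y 0 = (\<lambda>_. x0)" and Yz: "\<And>k. Y (Suc k) 0 = 0"
    and Y': "\<And>k t. t \<in> I \<Longrightarrow> (Y (Suc k) has_vector_derivative h (Y k t) (C t)) (at t)"
    by auto
  define X where "X = (\<lambda>t. \<Sum>k. Y k t)"
  have "X 0 = (\<Sum>k\<in>{0}. Y k 0)"
    unfolding X_def by (rule suminf_finite) (use Yz in \<open>auto simp: gr0_conv_Suc\<close>)
  then have "X 0 = x0" using Y0 by simp
  moreover have "(X has_vector_derivative h (X t) (C t)) (at t)" if t: "t \<in> I" for t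
  proof -
    obtain e where e: "e > 0" "cball t e \<subseteq> I" using I t open_contains_cball by blast
    obtain e0 where e0: "e0 > 0" "cball 0 e0 \<subseteq> I" using I open_contains_cball by blast
    \<comment> \<open>The estimates start at 0 and the derivative is taken at \<open>t\<close>, so
      the compact interval from \<open>a\<close> to \<open>b\<close> has to contain both in its
      interior.\<close>
    define a where "a = min (- e0) (t - e)"
    define b where "b = max e0 (t + e)"
    have ab: "a \<in> I" "b \<in> I" "a < 0" "0 < b" "a < t" "t < b"
      using e e0 by (auto simp: a_def b_def min_def max_def subset_iff dist_real_def)
    have sub: "{a..b} \<subseteq> I" using mem_is_interval_1_I[OF I(2) ab(1,2)] by auto
    obtain M where M: "0 \<le> M" "\<And>x s. s \<in> {a..b} \<Longrightarrow> norm (h x (C s)) \<le> M * norm x"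
      using bounded_bilinear_bound_on_compact[OF h compact_Icc continuous_on_subset[OF C sub]] by blast
    define r where "r = max (- a) b"
    let ?m = "\<lambda>k. norm x0 * ((M * r) ^ k /\<^sub>R fact k)"
    have bnd: "norm (Y k s) \<le> ?m k" if s: "s \<in> {a<..<b}" for k s
    proof -
      have "norm (Y k s) \<le> norm x0 * (M * \<bar>s\<bar>) ^ k / fact k"
        by (rule picard_bound[of "{a..b}" Y "norm x0" "\<lambda>k s. h (Y k s) (C s)" M])
           (use ab Y0 Yz Y' sub M s in \<open>auto simp: is_interval_cc\<close>)
      also have "\<dots> \<le> norm x0 * (M * r) ^ k / fact k"
        using s M by (intro divide_right_mono mult_left_mono power_mono) (auto simp: r_def)
      finally show ?thesis by (simp add: divide_inverse mult_ac)
    qed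
    have sm: "summable ?m" by (intro summable_mult summable_exp_generic)
    have sY: "summable (\<lambda>k. Y k s)" if "s \<in> {a<..<b}" for s
      by (rule summable_comparison_test[OF _ sm]) (use bnd that in auto)
    \<comment> \<open>\<open>D\<close> is the series of termwise derivatives. The derivative of
      \<open>Y (Suc j)\<close> involves \<open>Y j\<close>, hence the shift; \<open>Y 0\<close> is
      constant, hence the leading 0.\<close>
    define D where "D = (\<lambda>k s. case k of 0 \<Rightarrow> 0 | Suc j \<Rightarrow> h (Y j s) (C s))"
    have Ds: "(\<lambda>k. D k s) sums h (X s) (C s)" if s: "s \<in> {a<..<b}" for s
    proof -
      have "(\<lambda>k. h (Y k s) (C s)) sums h (X s) (C s)"
        using bounded_linear.sums[OF bounded_bilinear.bounded_linear_left[OF h]] sY[OF s]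
        unfolding X_def by (simp add: summable_sums)
      then have "(\<lambda>k. D (Suc k) s) sums h (X s) (C s)" by (simp add: D_def)
      then show ?thesis using sums_Suc[of "\<lambda>k. D k s"] by (simp add: D_def)
    qed
    have "uniform_limit {a<..<b} (\<lambda>n s. \<Sum>i<n. D i s) (\<lambda>s. \<Sum>i. D i s) sequentially"
    proof (rule Weierstrass_m_test)
      show "norm (D n s) \<le> (case n of 0 \<Rightarrow> 0 | Suc j \<Rightarrow> M * ?m j)" if s: "s \<in> {a<..<b}" for n s
      proof (cases n)
        case (Suc j)
        have "norm (h (Y j s) (C s)) \<le> M * norm (Y j s)" using M s by simp
        also have "\<dots> \<le> M * ?m j" using bnd[OF s] M by (intro mult_left_mono)
        finally show ?thesis using Suc by (simp add: D_def)
      qed (simp add: D_def)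
      show "summable (\<lambda>n. case n of 0 \<Rightarrow> 0 | Suc j \<Rightarrow> M * ?m j)"
        by (subst summable_Suc_iff[symmetric]) (use sm in \<open>simp add: summable_mult\<close>)
    qed
    then have ul: "uniform_limit {a<..<b} (\<lambda>n s. \<Sum>i<n. D i s) (\<lambda>s. h (X s) (C s)) sequentially"
      using uniform_limit_cong'[of "{a<..<b}" "\<lambda>n s. \<Sum>i<n. D i s" "\<lambda>n s. \<Sum>i<n. D i s"
          "\<lambda>s. \<Sum>i. D i s" "\<lambda>s. h (X s) (C s)" sequentially] sums_unique[OF Ds]
      by simp
    have "\<exists>g. \<forall>x\<in>{a<..<b}. (\<lambda>n. Y n x) sums (g x) \<and>
        (g has_derivative (\<lambda>u. u *\<^sub>R h (X x) (C x))) (at x within {a<..<b})"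
    proof (rule has_derivative_series)
      show "(Y n has_derivative (\<lambda>u. u *\<^sub>R D n s)) (at s within {a<..<b})" if "s \<in> {a<..<b}" for n s
      proof (cases n)
        case 0
        then show ?thesis by (simp add: Y0 D_def)
      next
        case (Suc j)
        have "s \<in> I" using sub that by auto
        then show ?thesis using Y'[of s j] unfolding Suc
          by (auto simp: D_def has_vector_derivative_def intro: has_derivative_at_withinI)
      qed
      show "\<forall>\<^sub>F n in sequentially. \<forall>x\<in>{a<..<b}. \<forall>u.
         norm ((\<Sum>i<n. u *\<^sub>R D i x) - u *\<^sub>R h (X x) (C x)) \<le> e * norm u" if "e > 0" for e
      proof -
        have "\<forall>\<^sub>F n in sequentially. \<forall>x\<in>{a<..<b}. dist (\<Sum>i<n. D i x) (h (X x) (C x)) < e"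
          using ul that unfolding uniform_limit_iff by blast
        then show ?thesis
        proof (eventually_elim, intro ballI allI)
          fix n x u assume "\<forall>x\<in>{a<..<b}. dist (\<Sum>i<n. D i x) (h (X x) (C x)) < e" "x \<in> {a<..<b}"
          then have "norm ((\<Sum>i<n. D i x) - h (X x) (C x)) \<le> e" by (auto simp: dist_norm less_imp_le)
          then have "\<bar>u\<bar> * norm ((\<Sum>i<n. D i x) - h (X x) (C x)) \<le> \<bar>u\<bar> * e"
            by (intro mult_left_mono) auto
          then show "norm ((\<Sum>i<n. u *\<^sub>R D i x) - u *\<^sub>R h (X x) (C x)) \<le> e * norm u"
            by (simp add: scaleR_right.sum[symmetric] scaleR_diff_right[symmetric] mult_ac)
        qed
      qed
      show "t \<in> {a<..<b}" using ab by simp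
      then show "(\<lambda>n. Y n t) sums X t" unfolding X_def using sY by (simp add: summable_sums)
    qed auto
    then obtain g where g: "\<And>x. x\<in>{a<..<b} \<Longrightarrow> (\<lambda>n. Y n x) sums (g x)"
        "\<And>x. x\<in>{a<..<b} \<Longrightarrow> (g has_derivative (\<lambda>u. u *\<^sub>R h (X x) (C x))) (at x within {a<..<b})"
      by blast
    have tab: "t \<in> {a<..<b}" using ab by simp
    have "(g has_vector_derivative h (X t) (C t)) (at t)"
      using g(2)[OF tab] tab by (simp add: has_vector_derivative_def at_within_open[of t "{a<..<b}"])
    then show ?thesis
      by (rule has_vector_derivative_transform_within_open[of _ _ _ "{a<..<b}"])
         (use tab g(1) sums_unique in \<open>auto simp: X_def\<close>)
  qed
  ultimately show ?thesis by (rule that)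
qed

subsection \<open>Curves of matrices\<close>

lemma bounded_bilinear_matrix_matrix_mult:
  "bounded_bilinear ((**) :: real^'n^'m \<Rightarrow> real^'p^'n \<Rightarrow> real^'p^'m)"
  unfolding bilinear_conv_bounded_bilinear[symmetric] bilinear_def
  by (auto intro!: linearI simp: matrix_matrix_mult_def vec_eq_iff algebra_simps sum.distrib sum_distrib_left)

lemma bounded_bilinear_matrix_vector_mult:
  "bounded_bilinear ((*v) :: real^'n^'m \<Rightarrow> real^'n \<Rightarrow> real^'m)"
  unfolding bilinear_conv_bounded_bilinear[symmetric] bilinear_def
  by (auto intro!: linearI simp: matrix_vector_mult_def vec_eq_iff algebra_simps sum.distrib sum_distrib_left)

interpretation mm: bounded_bilinear "(**) :: real^'n^'n \<Rightarrow> real^'n^'n \<Rightarrow> real^'n^'n"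
  by (rule bounded_bilinear_matrix_matrix_mult)

lemma has_vector_derivative_vec:
  fixes f :: "real \<Rightarrow> 'b::euclidean_space^'n"
  assumes "\<And>i. ((\<lambda>t. f t $ i) has_vector_derivative f' $ i) (at t)"
  shows "(f has_vector_derivative f') (at t)"
  unfolding has_vector_derivative_def
proof (subst has_derivative_componentwise_within, rule ballI)
  fix b :: "'b^'n" assume "b \<in> Basis"
  then obtain i u where b: "b = axis i u" by (auto simp: Basis_vec_def)
  have "((\<lambda>t. f t $ i \<bullet> u) has_vector_derivative f' $ i \<bullet> u) (at t)"
    by (rule bounded_linear.has_vector_derivative[OF bounded_linear_inner_left assms])
  then show "((\<lambda>x. f x \<bullet> b) has_derivative (\<lambda>x. x *\<^sub>R f' \<bullet> b)) (at t)"
    by (simp add: b inner_axis has_vector_derivative_def)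
qed

lemma differentiable_vec:
  fixes f :: "real \<Rightarrow> 'b::euclidean_space^'n"
  assumes "\<And>i. (\<lambda>t. f t $ i) differentiable (at t)"
  shows "f differentiable (at t)"
  using has_vector_derivative_vec[of f "\<chi> i. vector_derivative (\<lambda>t. f t $ i) (at t)" t] assms
  by (simp add: vector_derivative_works[symmetric]) (metis differentiableI_vector vector_derivative_works)

section \<open>Determinants and inverses of matrix curves\<close>

lemma differentiable_prod_real:
  fixes f :: "'i \<Rightarrow> real \<Rightarrow> real"
  assumes "\<And>i. i \<in> A \<Longrightarrow> f i differentiable (at t)"
  shows "(\<lambda>t. \<Prod>i\<in>A. f i t) differentiable (at t)"
  using assms by (induction A rule: infinite_finite_induct) auto

lemma differentiable_det:
  fixes A :: "real \<Rightarrow> real^'n^'n"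
  assumes "\<And>i j. (\<lambda>t. A t $ i $ j) differentiable (at t)"
  shows "(\<lambda>t. det (A t)) differentiable (at t)"
  unfolding det_def using assms
  by (intro differentiable_sum ballI differentiable_mult differentiable_prod_real) (auto simp: finite_permutations)

text \<open>\<open>matrix_inv\<close> is a choice among two-sided inverses; for square matrices one
  equation already forces the value.\<close>

lemma matrix_inv_eqI:
  fixes A B :: "real^'n^'n"
  assumes "A ** B = mat 1"
  shows "matrix_inv A = B"
proof -
  have BA: "B ** A = mat 1" using assms by (simp add: matrix_left_right_inverse)
  have "A ** matrix_inv A = mat 1"
    unfolding matrix_inv_def using someI[of "\<lambda>A'. A ** A' = mat 1 \<and> A' ** A = mat 1" B] assms BA
    by blast
  then have "B ** (A ** matrix_inv A) = B" by simp
  then show ?thesis by (simp add: matrix_mul_assoc BA)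
qed

lemma matrix_inv_inverse:
  fixes A :: "real^'n^'n"
  assumes "det A \<noteq> 0"
  shows "A ** matrix_inv A = mat 1" "matrix_inv A ** A = mat 1"
proof -
  obtain B where "A ** B = mat 1"
    using assms unfolding invertible_det_nz[symmetric] invertible_def by blast
  then show "A ** matrix_inv A = mat 1" using matrix_inv_eqI by blast
  then show "matrix_inv A ** A = mat 1" by (simp add: matrix_left_right_inverse)
qed

text \<open>Writes the entries as quotients of determinants, so that the inverse of a differentiable
  matrix curve is visibly differentiable.\<close>

lemma matrix_inv_cramer:
  fixes A :: "real^'n^'n"
  assumes "det A \<noteq> 0"
  shows "matrix_inv A = (\<chi> k l. det (\<chi> i j. if j = k then (if i = l then 1 else 0) else A $ i $ j) / det A)"
    (is "_ = ?B")
proof (rule matrix_inv_eqI)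
  have "A *v column l ?B = axis l 1" for l
    unfolding cramer[OF assms] by (auto simp: column_def axis_def vec_eq_iff if_distrib cong: if_cong)
  then have "(A *v column l ?B) $ i = axis l 1 $ i" for i l by simp
  moreover have "(A ** ?B) $ i $ l = (A *v column l ?B) $ i" for i l
    by (simp add: matrix_matrix_mult_def matrix_vector_mult_def column_def)
  ultimately show "A ** ?B = mat 1"
    by (simp add: vec_eq_iff mat_def axis_def)
qed

lemma has_vector_derivative_matrix_inv:
  fixes A :: "real \<Rightarrow> real^'n^'n"
  assumes A: "(A has_vector_derivative A') (at t)" and d: "det (A t) \<noteq> 0"
  shows "((\<lambda>s. matrix_inv (A s)) has_vector_derivative
           - (matrix_inv (A t) ** A' ** matrix_inv (A t))) (at t)"
proof -
  have ent: "(\<lambda>s. A s $ i $ j) differentiable (at t)" for i j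
    using bounded_linear.has_vector_derivative[OF bounded_linear_vec_nth
        bounded_linear.has_vector_derivative[OF bounded_linear_vec_nth A]]
    by (rule differentiableI_vector)
  have ddet: "(\<lambda>s. det (A s)) differentiable (at t)" by (rule differentiable_det[OF ent])
  then have "isCont (\<lambda>s. det (A s)) t" by (simp add: differentiable_imp_continuous_within)
  then have "\<forall>\<^sub>F s in nhds t. det (A s) \<noteq> 0"
    using d by (simp add: tendsto_imp_eventually_ne isCont_def eventually_nhds_conv_at)
  then obtain U where U: "open U" "t \<in> U" "\<And>s. s \<in> U \<Longrightarrow> det (A s) \<noteq> 0"
    unfolding eventually_nhds by blast
  let ?L = "\<lambda>s. \<chi> k l. det (\<chi> i j. if j = k then (if i = l then 1 else 0) else A s $ i $ j) / det (A s)"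
  have "?L differentiable (at t)"
  proof (intro differentiable_vec)
    fix k l
    have "(\<lambda>s. det (\<chi> i j. if j = k then (if i = l then 1 else 0) else A s $ i $ j)) differentiable (at t)"
    proof (rule differentiable_det)
      fix i j show "(\<lambda>s. (\<chi> i j. if j = k then (if i = l then 1 else 0) else A s $ i $ j) $ i $ j) differentiable (at t)"
        using ent by (cases "j = k") auto
    qed
    then show "(\<lambda>s. ?L s $ k $ l) differentiable (at t)"
      using ddet d by simp
  qed
  then have "(\<lambda>s. matrix_inv (A s)) differentiable (at t)"
    by (rule differentiable_cong_open[OF U(1,2), rotated]) (simp add: matrix_inv_cramer U(3))
  then obtain L' where L': "((\<lambda>s. matrix_inv (A s)) has_vector_derivative L') (at t)"
    using vector_derivative_works by blast
  \<comment> \<open>Differentiability is now known, so the value of the derivative follows by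
    differentiating the identity \<open>A ** matrix_inv A = mat 1\<close> near
    \<open>t\<close>.\<close>
  have "((\<lambda>s. A s ** matrix_inv (A s)) has_vector_derivative A t ** L' + A' ** matrix_inv (A t)) (at t)"
    by (rule mm.has_vector_derivative[OF A L'])
  moreover have "((\<lambda>s. A s ** matrix_inv (A s)) has_vector_derivative 0) (at t)"
    by (rule has_vector_derivative_transform_within_open[OF has_vector_derivative_const[of "mat 1"] U(1,2)])
       (simp add: matrix_inv_inverse U(3))
  ultimately have "A t ** L' + A' ** matrix_inv (A t) = 0"
    by (rule vector_derivative_unique_at)
  then have "A t ** L' = - (A' ** matrix_inv (A t))" by (rule eq_neg_iff_add_eq_0[THEN iffD2])
  then have "matrix_inv (A t) ** (A t ** L') = matrix_inv (A t) ** - (A' ** matrix_inv (A t))"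
    by (rule arg_cong)
  then have "L' = - (matrix_inv (A t) ** A' ** matrix_inv (A t))"
    by (simp add: matrix_mul_assoc matrix_inv_inverse d mm.minus_right)
  then show ?thesis using L' by simp
qed

text \<open>The derivative of the inverse is a product of \<open>A'\<close> and the inverse itself,
  so regularity improves one order at a time.\<close>

lemma smooth_matrix_inv:
  fixes A :: "real \<Rightarrow> real^'n^'n"
  assumes "open J" and A: "smooth_curve_on J A" and d: "\<And>t. t \<in> J \<Longrightarrow> det (A t) \<noteq> 0"
  shows "smooth_curve_on J (\<lambda>t. matrix_inv (A t))"
proof -
  have "Ck_on k J (\<lambda>t. matrix_inv (A t))" for k
  proof (induction k)
    case (Suc k)
    have "Ck_on (Suc k) J A" using smooth_imp_Ck_on[OF assms(1) A] .
    then obtain A' where A': "\<And>t. t \<in> J \<Longrightarrow> (A has_vector_derivative A' t) (at t)" "Ck_on k J A'"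
      unfolding Ck_on.simps by blast
    have "Ck_on k J (\<lambda>t. - (matrix_inv (A t) ** A' t ** matrix_inv (A t)))"
      by (intro Ck_on_bounded_linear[OF bounded_linear_minus[OF bounded_linear_ident]]
          Ck_on_bounded_bilinear[OF bounded_bilinear_matrix_matrix_mult] Suc.IH A'(2))
    then show ?case
      by (rule Ck_on_SucI[rotated]) (rule has_vector_derivative_matrix_inv[OF A'(1) d])
  qed simp
  then show ?thesis by (simp add: smooth_curve_on_iff_Ck_on assms)
qed

text \<open>The coordinate \<open>M = B A\<^sup>-\<^sup>1\<close> of the moving subspace satisfies a matrix Riccati equation; its
  second derivative simplifies because \<open>N = Q - M P\<close> solves a linear equation of its own.\<close>

lemma riccati_derivatives:
  fixes A B P Q S K :: "real \<Rightarrow> real^'n^'n"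
  assumes A: "(A has_vector_derivative A t ** S t + P t) (at t)"
    and B: "(B has_vector_derivative B t ** S t + Q t) (at t)"
    and P: "(P has_vector_derivative A t ** K t + P t ** S t) (at t)"
    and Q: "(Q has_vector_derivative B t ** K t + Q t ** S t) (at t)"
    and d: "det (A t) \<noteq> 0"
  defines "L \<equiv> \<lambda>t. matrix_inv (A t)"
  defines "N \<equiv> \<lambda>t. Q t - B t ** L t ** P t"
  shows "((\<lambda>t. B t ** L t) has_vector_derivative N t ** L t) (at t)" (is ?M)
    and "((\<lambda>t. N t ** L t) has_vector_derivative - 2 *\<^sub>R (N t ** L t ** (P t ** L t))) (at t)" (is ?NL)
    and "((\<lambda>t. P t ** L t) has_vector_derivative
            (A t ** K t ** L t - P t ** L t ** (P t ** L t))) (at t)" (is ?PL)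
proof -
  have Lt: "matrix_inv (A t) = L t" by (simp add: L_def)
  have LA: "L t ** A t = mat 1" and AL: "A t ** L t = mat 1"
    unfolding L_def using matrix_inv_inverse[OF d] by auto
  have XLA: "X ** L t ** A t = X" and XAL: "X ** A t ** L t = X" for X :: "real^'n^'n"
    by (simp_all add: LA AL matrix_mul_assoc[symmetric])
  note alg = mm.add_left mm.add_right mm.diff_left mm.diff_right mm.minus_left mm.minus_right
    matrix_mul_assoc LA AL XLA XAL
  have L: "(L has_vector_derivative - (S t ** L t + L t ** P t ** L t)) (at t)"
    using has_vector_derivative_matrix_inv[OF A d] unfolding Lt unfolding L_def[symmetric]
    by (simp add: alg)
  show M: ?M
    by (rule has_vector_derivative_eq_rhs[OF mm.has_vector_derivative[OF B L]])
       (simp add: alg N_def)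
  \<comment> \<open>The terms with \<open>K\<close> cancel because \<open>M A = B\<close>; this is
    why \<open>N\<close> obeys a linear equation free of \<open>K\<close>.\<close>
  have N: "(N has_vector_derivative N t ** S t - N t ** L t ** P t) (at t)"
    unfolding N_def
    by (rule has_vector_derivative_eq_rhs[OF has_vector_derivative_diff[OF Q mm.has_vector_derivative[OF M P]]])
       (simp add: alg N_def)
  show ?NL
    by (rule has_vector_derivative_eq_rhs[OF mm.has_vector_derivative[OF N L]])
       (simp add: alg scaleR_2)
  show ?PL
    by (rule has_vector_derivative_eq_rhs[OF mm.has_vector_derivative[OF P L]])
       (simp add: alg)
qed

subsection \<open>Symplectic bases\<close>

text \<open>Coordinates are kept as vectors in \<open>real^'n\<close>, so that linear maps between
  spans become matrix products.\<close>

definition lincomb :: "('n::finite \<Rightarrow> 'a::real_vector) \<Rightarrow> real^'n \<Rightarrow> 'a" where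
  "lincomb b c = (\<Sum>i\<in>UNIV. c $ i *\<^sub>R b i)"

lemma linear_lincomb: "linear (lincomb b)"
  by (auto intro!: linearI simp: lincomb_def scaleR_add_left sum.distrib scaleR_right.sum)

lemma lincomb_axis [simp]: "lincomb b (axis i 1) = b i"
  by (simp add: lincomb_def axis_def if_distrib[of "\<lambda>x. x *\<^sub>R _"] cong: if_cong)

lemma lincomb_add: "lincomb b (c + d) = lincomb b c + lincomb b d"
  and lincomb_diff: "lincomb b (c - d) = lincomb b c - lincomb b d"
  and lincomb_scaleR: "lincomb b (r *\<^sub>R c) = r *\<^sub>R lincomb b c"
  and lincomb_0 [simp]: "lincomb b 0 = 0"
  using linear_lincomb[of b] by (auto simp: linear_add linear_diff linear_scale linear_0)

lemma range_lincomb: "range (lincomb b) = span (range b)"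
proof
  show "range (lincomb b) \<subseteq> span (range b)"
    unfolding lincomb_def by (blast intro: span_sum span_scale span_base)
  show "span (range b) \<subseteq> range (lincomb b)"
  proof (rule span_minimal)
    show "range b \<subseteq> range (lincomb b)" by (metis image_subsetI lincomb_axis rangeI)
    show "subspace (range (lincomb b))"
      using linear_lincomb linear_subspace_image subspace_UNIV by blast
  qed
qed

lemma lincomb_eq_iff:
  assumes "inj b" "independent (range b)"
  shows "lincomb b c = lincomb b d \<longleftrightarrow> c = d"
proof
  assume "lincomb b c = lincomb b d"
  then have "(\<Sum>i\<in>UNIV. (c - d) $ i *\<^sub>R b i) = 0"
    by (simp add: lincomb_def scaleR_diff_left sum_subtractf)
  then have "(\<Sum>v\<in>range b. (c - d) $ (inv b v) *\<^sub>R v) = 0"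
    by (subst sum.reindex[OF assms(1)]) (simp add: assms(1))
  then have "\<forall>v\<in>range b. (c - d) $ (inv b v) = 0"
    using assms(2) independentD[of "range b" "range b" "\<lambda>v. (c - d) $ (inv b v)"] by auto
  then have "\<forall>i. (c - d) $ i = 0" using assms(1) by auto
  then show "c = d" by (simp add: vec_eq_iff)
qed simp

lemma basis_of_lincombI:
  assumes "range (lincomb b) = V" "\<And>c. lincomb b c = 0 \<Longrightarrow> c = 0"
  shows "basis_of V b"
proof -
  have i: "inj (lincomb b)"
    using assms(2) linear_lincomb linear_injective_0 by blast
  have inj: "inj b"
  proof (rule injI)
    fix i j assume "b i = b j"
    then have "lincomb b (axis i 1) = lincomb b (axis j 1)" by simp
    then show "i = j" using i by (metis axis_eq_axis injD zero_neq_one)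
  qed
  have "independent (range b)"
    unfolding independent_explicit
  proof (intro conjI allI impI ballI)
    fix u v assume u: "(\<Sum>v\<in>range b. u v *\<^sub>R v) = 0" and v: "v \<in> range b"
    have "lincomb b (\<chi> i. u (b i)) = 0"
      using u by (subst (asm) sum.reindex[OF inj]) (simp add: lincomb_def)
    then have "(\<chi> i. u (b i)) = 0" by (rule assms(2))
    then show "u v = 0" using v by (auto simp: vec_eq_iff)
  qed simp
  then show ?thesis using inj assms(1) by (simp add: basis_of_def range_lincomb)
qed

text \<open>The subspaces transverse to the span of \<open>e\<close> are the ranges of these maps (\<open>transversal_is_chart\<close>).\<close>

definition sheared_lincomb ::
    "('n::finite \<Rightarrow> 'a::real_vector) \<Rightarrow> ('n \<Rightarrow> 'a) \<Rightarrow> real^'n^'n \<Rightarrow> real^'n \<Rightarrow> 'a" where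
  "sheared_lincomb e e' Z y = lincomb e' y + lincomb e (Z *v y)"

lemma sum_UNIV_sum:
  "(\<Sum>i\<in>(UNIV :: ('n::finite + 'm::finite) set). g i) = (\<Sum>i\<in>UNIV. g (Inl i)) + (\<Sum>i\<in>UNIV. g (Inr i))"
  unfolding UNIV_sum by (subst sum.union_disjoint) (auto simp: sum.reindex)

locale symplectic_space =
  fixes \<omega> :: "'a::euclidean_space \<Rightarrow> 'a \<Rightarrow> real"
  assumes form: "symplectic_form \<omega>"
begin

sublocale bb: bounded_bilinear \<omega>
  using form unfolding symplectic_form_def bilinear_conv_bounded_bilinear by blast

lemma self [simp]: "\<omega> v v = 0"
  using form by (simp add: symplectic_form_def)

lemma skew: "\<omega> u v = - \<omega> v u"
proof -
  have "\<omega> (u + v) (u + v) = \<omega> u u + \<omega> v v + (\<omega> u v + \<omega> v u)"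
    unfolding bb.add_left bb.add_right by simp
  then show ?thesis by simp
qed

lemma omega_lincomb_left: "\<omega> (lincomb b c) v = (\<Sum>i\<in>UNIV. c $ i * \<omega> (b i) v)"
  by (simp add: lincomb_def bb.sum_left bb.scaleR_left)

lemma omega_lincomb_right: "\<omega> v (lincomb b c) = (\<Sum>i\<in>UNIV. c $ i * \<omega> v (b i))"
  by (simp add: lincomb_def bb.sum_right bb.scaleR_right)

end

text \<open>\<open>e'\<close> stands for the paper's barred vectors.\<close>

locale symplectic_frame = symplectic_space \<omega>
  for \<omega> :: "'a::euclidean_space \<Rightarrow> 'a \<Rightarrow> real" +
  fixes e e' :: "'n::finite \<Rightarrow> 'a"
  assumes ee: "\<And>i j. \<omega> (e i) (e j) = 0" and ee': "\<And>i j. \<omega> (e i) (e' j) = (if i = j then 1 else 0)"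
    and e'e': "\<And>i j. \<omega> (e' i) (e' j) = 0"
    and dim: "DIM('a) = 2 * CARD('n)"
begin

lemma e'e: "\<omega> (e' i) (e j) = (if i = j then - 1 else 0)"
  using skew[of "e' i" "e j"] ee'[of j i] by auto

lemma coord_e': "\<omega> (e i) (lincomb e c + lincomb e' d) = d $ i"
  by (simp add: bb.add_right omega_lincomb_right ee ee' if_distrib[of "\<lambda>x. _ * x"] cong: if_cong)

lemma coord_e: "\<omega> (lincomb e c + lincomb e' d) (e' i) = c $ i"
  by (simp add: bb.add_left omega_lincomb_left e'e' ee' if_distrib[of "\<lambda>x. _ * x"] cong: if_cong)

lemma lincomb_pair_inj:
  "lincomb e c + lincomb e' d = lincomb e c2 + lincomb e' d2 \<longleftrightarrow> c = c2 \<and> d = d2"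
  (is "?l = ?r \<longleftrightarrow> _")
proof
  assume eq: "?l = ?r"
  have "c $ i = c2 $ i" "d $ i = d2 $ i" for i
    using arg_cong[OF eq, of "\<lambda>v. \<omega> v (e' i)"] arg_cong[OF eq, of "\<omega> (e i)"]
    by (simp_all only: coord_e coord_e')
  then show "c = c2 \<and> d = d2" by (simp add: vec_eq_iff)
qed simp

lemma e_inj: "lincomb e c = lincomb e c2 \<longleftrightarrow> c = c2"
  using lincomb_pair_inj[of c 0 c2 0] by simp

lemma e'_inj: "lincomb e' c = lincomb e' c2 \<longleftrightarrow> c = c2"
  using lincomb_pair_inj[of 0 c 0 c2] by simp

lemma basis_e: "basis_of (range (lincomb e)) e"
  by (rule basis_of_lincombI) (use e_inj[of _ 0] in auto)

lemma basis_e': "basis_of (range (lincomb e')) e'"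
  by (rule basis_of_lincombI) (use e'_inj[of _ 0] in auto)

text \<open>Pairing with the dual vectors recovers the coefficients, so the map from coefficient
  pairs is injective; the dimension hypothesis makes it surjective.\<close>

lemma expansion: "v = lincomb e (\<chi> i. \<omega> v (e' i)) + lincomb e' (\<chi> i. \<omega> (e i) v)"
proof -
  let ?T = "\<lambda>p::(real^'n) \<times> (real^'n). lincomb e (fst p) + lincomb e' (snd p)"
  have lin: "linear ?T"
    by (auto intro!: linearI simp: lincomb_add lincomb_scaleR algebra_simps)
  have "inj ?T" by (auto intro!: injI simp: lincomb_pair_inj prod_eq_iff)
  then have "dim (range ?T) = DIM('a)"
    using dim_image_eq[OF lin, of UNIV] dim by (simp add: inj_on_subset)
  then have "range ?T = UNIV"
    using dim_eq_full[of "range ?T"] span_eq_iff[of "range ?T"]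
      linear_subspace_image[OF lin subspace_UNIV] by simp
  then obtain c d where v: "v = lincomb e c + lincomb e' d" by blast
  show ?thesis unfolding v coord_e coord_e' by simp
qed

lemma symplectic_basis_case_sum: "symplectic_basis \<omega> (case_sum e e')"
proof -
  have sp: "lincomb (case_sum e e') c = lincomb e (\<chi> i. c $ Inl i) + lincomb e' (\<chi> i. c $ Inr i)" for c
    by (simp add: lincomb_def sum_UNIV_sum)
  have "basis_of UNIV (case_sum e e')"
  proof (rule basis_of_lincombI)
    show "range (lincomb (case_sum e e')) = UNIV"
    proof (intro equalityI subsetI)
      fix v
      have "v = lincomb (case_sum e e') (\<chi> k. case k of Inl i \<Rightarrow> \<omega> v (e' i) | Inr i \<Rightarrow> \<omega> (e i) v)"
        unfolding sp by (subst expansion) simp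
      then show "v \<in> range (lincomb (case_sum e e'))" by blast
    qed simp
    fix c :: "real^('n + 'n)" assume "lincomb (case_sum e e') c = 0"
    then have "(\<chi> i. c $ Inl i) = 0 \<and> (\<chi> i. c $ Inr i) = 0"
      unfolding sp using lincomb_pair_inj[of _ _ 0 0] by simp
    then have "c $ k = 0" for k by (cases k) (auto simp: vec_eq_iff)
    then show "c = 0" by (simp add: vec_eq_iff)
  qed
  then show ?thesis by (simp add: symplectic_basis_def ee ee' e'e')
qed

lemma dim_e: "dim (range (lincomb e)) = CARD('n)" and dim_e': "dim (range (lincomb e')) = CARD('n)"
proof -
  have "dim (range (lincomb b)) = CARD('n)" if "basis_of (range (lincomb b)) b" for b :: "'n \<Rightarrow> 'a"
    using that unfolding basis_of_def
    by (simp add: dim_eq_card_independent dim_span range_lincomb card_image)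
  then show "dim (range (lincomb e)) = CARD('n)" "dim (range (lincomb e')) = CARD('n)"
    using basis_e basis_e' by blast+
qed

lemma subspace_range_lincomb: "subspace (range (lincomb b))"
  by (simp add: range_lincomb)

lemma lagrangian_e: "lagrangian \<omega> (range (lincomb e))"
  by (auto simp: lagrangian_def subspace_range_lincomb dim_e dim omega_lincomb_left omega_lincomb_right ee)

lemma lagrangian_e': "lagrangian \<omega> (range (lincomb e'))"
  by (auto simp: lagrangian_def subspace_range_lincomb dim_e' dim omega_lincomb_left omega_lincomb_right e'e')

abbreviation chart :: "real^'n^'n \<Rightarrow> real^'n \<Rightarrow> 'a" where
  "chart \<equiv> sheared_lincomb e e'"

lemmas chart_def = sheared_lincomb_def

lemma linear_chart: "linear (chart Z)"
  unfolding chart_def[abs_def]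
  by (intro linear_compose_add linear_lincomb linear_compose[OF matrix_vector_mul_linear linear_lincomb, unfolded o_def])

lemma chart_0 [simp]: "chart 0 = lincomb e'"
  by (simp add: chart_def fun_eq_iff)

lemma chart_pair_inj:
  "lincomb e c + chart Z y = lincomb e c2 + chart Z y2 \<longleftrightarrow> c = c2 \<and> y = y2"
proof -
  have "lincomb e c + chart Z y = lincomb e (c + Z *v y) + lincomb e' y" for c y
    by (simp add: chart_def lincomb_add)
  then show ?thesis by (auto simp: lincomb_pair_inj)
qed

text \<open>By dimensions, \<open>D\<close> and the span of \<open>e\<close> together fill the
  space, so each \<open>e' i\<close> can be moved into \<open>D\<close> by a vector of that span.
  The corrections are the columns of \<open>Z\<close>, and equal dimension gives equality.\<close>

lemma transversal_is_chart:
  assumes "D \<in> transversals \<omega> (range (lincomb e))"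
  obtains Z where "D = range (chart Z)"
proof -
  let ?E = "range (lincomb e)"
  have D: "subspace D" "2 * dim D = DIM('a)" "D \<inter> ?E = {0}"
    using assms by (auto simp: transversals_def lagrangian_def)
  have "dim {x + y |x y. x \<in> D \<and> y \<in> ?E} + dim (D \<inter> ?E) = dim D + dim ?E"
    by (rule dim_sums_Int[OF D(1) subspace_range_lincomb])
  then have "dim {x + y |x y. x \<in> D \<and> y \<in> ?E} = DIM('a)"
    using D dim_e dim by simp
  then have full: "{x + y |x y. x \<in> D \<and> y \<in> ?E} = UNIV"
    using subspace_sums[OF D(1) subspace_range_lincomb[of e]]
      dim_eq_full[of "{x + y |x y. x \<in> D \<and> y \<in> ?E}"] span_eq_iff[of "{x + y |x y. x \<in> D \<and> y \<in> ?E}"]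
    by simp
  have "\<exists>z. e' i + lincomb e z \<in> D" for i
  proof -
    obtain x c where "e' i = x + lincomb e c" "x \<in> D" using full by blast
    then have "e' i + lincomb e (- c) \<in> D"
      using lincomb_diff[of e 0 c] by simp
    then show ?thesis by blast
  qed
  then obtain z where z: "\<And>i. e' i + lincomb e (z i) \<in> D" by metis
  define Z where "Z = (\<chi> k i. z i $ k)"
  have "chart Z (axis i 1) = e' i + lincomb e (z i)" for i
    by (simp add: chart_def matrix_vector_mult_basis column_def Z_def)
  then have ch: "chart Z (axis i 1) \<in> D" for i using z by simp
  have "chart Z y \<in> D" for y
  proof -
    have "chart Z y = chart Z (\<Sum>i\<in>UNIV. y $ i *\<^sub>R axis i 1)"
      using basis_expansion[of y] by (simp add: scalar_mult_eq_scaleR)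
    also have "\<dots> = (\<Sum>i\<in>UNIV. y $ i *\<^sub>R chart Z (axis i 1))"
      by (simp add: linear_sum[OF linear_chart] linear_scale[OF linear_chart])
    also have "\<dots> \<in> D" using ch D(1) by (intro subspace_sum subspace_scale) auto
    finally show ?thesis .
  qed
  then have sub: "range (chart Z) \<subseteq> D" by blast
  have "inj (chart Z)" using chart_pair_inj[of 0 Z _ 0] by (auto intro: injI)
  then have "dim (range (chart Z)) = CARD('n)"
    using dim_image_eq[OF linear_chart, of Z UNIV] by simp
  then have "range (chart Z) = D"
    using sub D dim linear_subspace_image[OF linear_chart subspace_UNIV]
    by (intro subspace_dim_equal) auto
  then show ?thesis using that by blast
qed

end

subsection \<open>The curve of a moving frame\<close>

lemma Ck_on_vec:
  fixes f :: "real \<Rightarrow> 'b::euclidean_space^'n"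
  assumes "\<And>i. Ck_on k J (\<lambda>t. f t $ i)"
  shows "Ck_on k J f"
  using assms
proof (induction k arbitrary: f)
  case (Suc k)
  then have "\<forall>i. \<exists>g'. (\<forall>t\<in>J. ((\<lambda>t. f t $ i) has_vector_derivative g' t) (at t)) \<and> Ck_on k J g'"
    by simp
  then obtain g' where g': "\<And>i t. t \<in> J \<Longrightarrow> ((\<lambda>t. f t $ i) has_vector_derivative g' i t) (at t)"
    "\<And>i. Ck_on k J (g' i)"
    by metis
  have "Ck_on k J (\<lambda>t. \<chi> i. g' i t)"
    by (rule Suc.IH) (simp add: g'(2))
  then show ?case
    by (rule Ck_on_SucI[rotated]) (use g'(1) in \<open>auto intro!: has_vector_derivative_vec\<close>)
qed simp

locale moving_frame = symplectic_space \<omega>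
  for \<omega> :: "'a::euclidean_space \<Rightarrow> 'a \<Rightarrow> real" +
  fixes I :: "real set" and S K :: "real \<Rightarrow> real^'n^'n" and f g :: "real \<Rightarrow> 'n::finite \<Rightarrow> 'a"
  assumes I: "open I"
    and smooth_f: "\<And>i. smooth_curve_on I (\<lambda>t. f t i)" and smooth_g: "\<And>i. smooth_curve_on I (\<lambda>t. g t i)"
    and frame: "\<And>t. t \<in> I \<Longrightarrow> symplectic_frame \<omega> (f t) (g t)"
    and f': "\<And>t j. t \<in> I \<Longrightarrow>
      ((\<lambda>t. f t j) has_vector_derivative lincomb (f t) (column j (S t)) + g t j) (at t)"
    and g': "\<And>t j. t \<in> I \<Longrightarrow>
      ((\<lambda>t. g t j) has_vector_derivative lincomb (f t) (column j (K t)) + lincomb (g t) (column j (S t))) (at t)"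
begin

section \<open>Coordinates of the moving subspace relative to the frame at a fixed time\<close>

definition curve :: "real \<Rightarrow> 'a set" where
  "curve t = range (lincomb (f t))"

text \<open>\<open>cA\<close>, \<open>cB\<close>, \<open>cP\<close>, \<open>cQ\<close> are the coordinates of \<open>f t\<close> and \<open>g t\<close> in the basis consisting of
  \<open>f \<tau>\<close> and of the vectors \<open>g \<tau>\<close> sheared by \<open>Z\<close>, as in \<open>sheared_lincomb\<close>.\<close>

definition cA :: "real \<Rightarrow> real^'n^'n \<Rightarrow> real \<Rightarrow> real^'n^'n" where
  "cA \<tau> Z t = (\<chi> i j. \<omega> (f t j) (g \<tau> i)) - Z ** (\<chi> i j. \<omega> (f \<tau> i) (f t j))"

definition cB :: "real \<Rightarrow> real \<Rightarrow> real^'n^'n" where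
  "cB \<tau> t = (\<chi> i j. \<omega> (f \<tau> i) (f t j))"

definition cP :: "real \<Rightarrow> real^'n^'n \<Rightarrow> real \<Rightarrow> real^'n^'n" where
  "cP \<tau> Z t = (\<chi> i j. \<omega> (g t j) (g \<tau> i)) - Z ** (\<chi> i j. \<omega> (f \<tau> i) (g t j))"

definition cQ :: "real \<Rightarrow> real \<Rightarrow> real^'n^'n" where
  "cQ \<tau> t = (\<chi> i j. \<omega> (f \<tau> i) (g t j))"

text \<open>A general family of functionals covers pairing with a base vector in either slot of
  \<open>\<omega>\<close>, as the different coordinate matrices require.\<close>

lemma matrix_deriv_f:
  fixes l :: "'n \<Rightarrow> 'a \<Rightarrow> real"
  assumes "t \<in> I" "\<And>i. bounded_linear (l i)"
  shows "((\<lambda>t. l i (f t j)) has_vector_derivative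
    ((\<chi> i j. l i (f t j)) ** S t + (\<chi> i j. l i (g t j))) $ i $ j) (at t)"
proof -
  interpret l: bounded_linear "l i" by (rule assms(2))
  show ?thesis
    by (rule has_vector_derivative_eq_rhs[OF l.has_vector_derivative[OF f'[OF assms(1)]]])
       (simp add: l.add l.sum l.scaleR lincomb_def column_def matrix_matrix_mult_def mult.commute)
qed

lemma matrix_deriv_g:
  fixes l :: "'n \<Rightarrow> 'a \<Rightarrow> real"
  assumes "t \<in> I" "\<And>i. bounded_linear (l i)"
  shows "((\<lambda>t. l i (g t j)) has_vector_derivative
    ((\<chi> i j. l i (f t j)) ** K t + (\<chi> i j. l i (g t j)) ** S t) $ i $ j) (at t)"
proof -
  interpret l: bounded_linear "l i" by (rule assms(2))
  show ?thesis
    by (rule has_vector_derivative_eq_rhs[OF l.has_vector_derivative[OF g'[OF assms(1)]]])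
       (simp add: l.add l.sum l.scaleR lincomb_def column_def matrix_matrix_mult_def mult.commute)
qed

lemma deriv_cB: 
  assumes "t \<in> I"
  shows "(cB \<tau> has_vector_derivative cB \<tau> t ** S t + cQ \<tau> t) (at t)"
  using matrix_deriv_f[OF assms, of "\<lambda>i. \<omega> (f \<tau> i)"] bb.bounded_linear_right
  unfolding cB_def[abs_def] cQ_def by (intro has_vector_derivative_vec) simp

lemma deriv_cQ: 
  assumes "t \<in> I"
  shows "(cQ \<tau> has_vector_derivative cB \<tau> t ** K t + cQ \<tau> t ** S t) (at t)"
  using matrix_deriv_g[OF assms, of "\<lambda>i. \<omega> (f \<tau> i)"] bb.bounded_linear_right
  unfolding cQ_def[abs_def] cB_def by (intro has_vector_derivative_vec) simp

text \<open>The frame equations multiply from the right and so commute with left multiplication by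
  the constant \<open>Z\<close>. Every shear therefore obeys the same system, and
  \<open>riccati_derivatives\<close> applies in each chart.\<close>

lemma deriv_cA: 
  assumes "t \<in> I"
  shows "(cA \<tau> Z has_vector_derivative cA \<tau> Z t ** S t + cP \<tau> Z t) (at t)"
proof -
  have "((\<lambda>t. \<chi> i j. \<omega> (f t j) (g \<tau> i)) has_vector_derivative
     (\<chi> i j. \<omega> (f t j) (g \<tau> i)) ** S t + (\<chi> i j. \<omega> (g t j) (g \<tau> i))) (at t)"
    using matrix_deriv_f[OF assms, of "\<lambda>i v. \<omega> v (g \<tau> i)"] bb.bounded_linear_left
    by (intro has_vector_derivative_vec) simp
  from has_vector_derivative_diff[OF this
      bounded_linear.has_vector_derivative[OF mm.bounded_linear_right deriv_cB[OF assms]]]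
  show ?thesis
    unfolding cA_def[abs_def] cP_def cB_def cQ_def
    by (rule has_vector_derivative_eq_rhs) (simp add: mm.diff_left mm.add_right matrix_mul_assoc)
qed

lemma deriv_cP: 
  assumes "t \<in> I"
  shows "(cP \<tau> Z has_vector_derivative cA \<tau> Z t ** K t + cP \<tau> Z t ** S t) (at t)"
proof -
  have "((\<lambda>t. \<chi> i j. \<omega> (g t j) (g \<tau> i)) has_vector_derivative
     (\<chi> i j. \<omega> (f t j) (g \<tau> i)) ** K t + (\<chi> i j. \<omega> (g t j) (g \<tau> i)) ** S t) (at t)"
    using matrix_deriv_g[OF assms, of "\<lambda>i v. \<omega> v (g \<tau> i)"] bb.bounded_linear_left
    by (intro has_vector_derivative_vec) simp
  from has_vector_derivative_diff[OF this
      bounded_linear.has_vector_derivative[OF mm.bounded_linear_right deriv_cQ[OF assms]]]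
  show ?thesis
    unfolding cA_def cP_def[abs_def] cB_def cQ_def
    by (rule has_vector_derivative_eq_rhs) (simp add: mm.diff_left mm.add_right matrix_mul_assoc)
qed

lemma smooth_cB: "smooth_curve_on I (cB \<tau>)"
  unfolding smooth_curve_on_iff_Ck_on[OF I] cB_def[abs_def]
  by (intro allI Ck_on_vec)
     (simp add: Ck_on_bounded_linear[OF bb.bounded_linear_right smooth_imp_Ck_on[OF I smooth_f]])

lemma smooth_cA: "smooth_curve_on I (cA \<tau> Z)"
proof -
  have "Ck_on k I (\<lambda>t. \<chi> i j. \<omega> (f t j) (g \<tau> i))" for k
    by (intro Ck_on_vec)
       (simp add: Ck_on_bounded_linear[OF bb.bounded_linear_left smooth_imp_Ck_on[OF I smooth_f]])
  moreover have "Ck_on k I (\<lambda>t. - (Z ** cB \<tau> t))" for k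
    by (intro Ck_on_bounded_linear[OF bounded_linear_minus[OF mm.bounded_linear_right]]
        smooth_imp_Ck_on[OF I smooth_cB])
  ultimately have "Ck_on k I (\<lambda>t. (\<chi> i j. \<omega> (f t j) (g \<tau> i)) + - (Z ** cB \<tau> t))" for k
    by (rule Ck_on_add)
  then show ?thesis
    unfolding smooth_curve_on_iff_Ck_on[OF I] cA_def[abs_def] cB_def by simp
qed

lemma coords_at_base:
  assumes "\<tau> \<in> I"
  shows "cA \<tau> Z \<tau> = mat 1" "cB \<tau> \<tau> = 0" "cP \<tau> Z \<tau> = - Z" "cQ \<tau> \<tau> = mat 1"
proof -
  interpret symplectic_frame \<omega> "f \<tau>" "g \<tau>" using frame assms .
  show B: "cB \<tau> \<tau> = 0" by (simp add: cB_def ee vec_eq_iff)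
  show Q: "cQ \<tau> \<tau> = mat 1" by (simp add: cQ_def ee' vec_eq_iff mat_def)
  show "cA \<tau> Z \<tau> = mat 1"
    unfolding cA_def cB_def[symmetric] B by (simp add: ee' vec_eq_iff mat_def)
  show "cP \<tau> Z \<tau> = - Z"
    unfolding cP_def cQ_def[symmetric] Q by (simp add: e'e' vec_eq_iff)
qed

lemma lincomb_coords:
  assumes "\<tau> \<in> I"
  shows "lincomb (f t) c = lincomb (f \<tau>) (cA \<tau> Z t *v c) + sheared_lincomb (f \<tau>) (g \<tau>) Z (cB \<tau> t *v c)"
proof -
  interpret symplectic_frame \<omega> "f \<tau>" "g \<tau>" using frame assms .
  let ?A = "\<chi> i j. \<omega> (f t j) (g \<tau> i)"
  have "lincomb (f t) c = lincomb (f \<tau>) (?A *v c) + lincomb (g \<tau>) (cB \<tau> t *v c)"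
    by (subst expansion) (simp add: omega_lincomb_left omega_lincomb_right cB_def
        matrix_vector_mult_def mult.commute)
  \<comment> \<open>A coefficient vector \<open>y\<close> along \<open>g \<tau>\<close> becomes a
    sheared vector at the cost of \<open>Z *v y\<close> along \<open>f \<tau>\<close>; the
    subtraction inside \<open>cA\<close> pays for it.\<close>
  also have "?A *v c = cA \<tau> Z t *v c + Z *v (cB \<tau> t *v c)"
    by (simp add: cA_def cB_def matrix_vector_mult_diff_rdistrib matrix_vector_mul_assoc)
  finally show ?thesis by (simp add: chart_def lincomb_add)
qed

text \<open>Invertibility of \<open>cA\<close> is what allows the moving subspace to be written as a
  graph over \<open>curve \<tau>\<close>.\<close>

definition chart_dom :: "real \<Rightarrow> real^'n^'n \<Rightarrow> real set" where
  "chart_dom \<tau> Z = {t\<in>I. det (cA \<tau> Z t) \<noteq> 0}"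

definition coord :: "real \<Rightarrow> real^'n^'n \<Rightarrow> real \<Rightarrow> real^'n^'n" where
  "coord \<tau> Z t = cB \<tau> t ** matrix_inv (cA \<tau> Z t)"

lemma open_chart_dom: "open (chart_dom \<tau> Z)"
proof -
  have "continuous_on I (\<lambda>t. det (cA \<tau> Z t))"
  proof (rule continuous_at_imp_continuous_on, rule ballI)
    fix t assume "t \<in> I"
    have "(\<lambda>s. cA \<tau> Z s $ i $ j) differentiable (at t)" for i j
      using bounded_linear.has_vector_derivative[OF bounded_linear_vec_nth
          bounded_linear.has_vector_derivative[OF bounded_linear_vec_nth deriv_cA[OF \<open>t \<in> I\<close>]]]
      by (rule differentiableI_vector)
    then show "isCont (\<lambda>t. det (cA \<tau> Z t)) t"
      by (intro differentiable_imp_continuous_within differentiable_det)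
  qed
  then have "open (I \<inter> (\<lambda>t. det (cA \<tau> Z t)) -` (- {0}))"
    using I by (intro continuous_open_preimage) auto
  moreover have "I \<inter> (\<lambda>t. det (cA \<tau> Z t)) -` (- {0}) = chart_dom \<tau> Z"
    by (auto simp: chart_dom_def)
  ultimately show ?thesis by simp
qed

lemma base_in_chart_dom: "\<tau> \<in> I \<Longrightarrow> \<tau> \<in> chart_dom \<tau> Z"
  by (simp add: chart_dom_def coords_at_base)

lemma chart_dom_subset: "chart_dom \<tau> Z \<subseteq> I"
  by (auto simp: chart_dom_def)

lemma smooth_coord: "smooth_curve_on (chart_dom \<tau> Z) (coord \<tau> Z)"
proof -
  have sub: "smooth_curve_on (chart_dom \<tau> Z) h" if "smooth_curve_on I h" for h :: "real \<Rightarrow> real^'n^'n"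
    using that chart_dom_subset unfolding smooth_curve_on_def by blast
  have "smooth_curve_on (chart_dom \<tau> Z) (\<lambda>t. matrix_inv (cA \<tau> Z t))"
    by (rule smooth_matrix_inv[OF open_chart_dom sub[OF smooth_cA]]) (simp add: chart_dom_def)
  then show ?thesis
    using sub[OF smooth_cB, of \<tau>] unfolding smooth_curve_on_iff_Ck_on[OF open_chart_dom] coord_def[abs_def]
    by (intro allI Ck_on_bounded_bilinear[OF bounded_bilinear_matrix_matrix_mult]) auto
qed

text \<open>Reparametrizing the coefficients by the inverse of \<open>cA\<close> turns the component
  along \<open>f \<tau>\<close> into the free parameter, which leaves a graph with matrix
  \<open>coord \<tau> Z t\<close>.\<close>

lemma curve_in_chart:
  assumes "\<tau> \<in> I" "t \<in> chart_dom \<tau> Z"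
  shows "curve t = {lincomb (f \<tau>) c + sheared_lincomb (f \<tau>) (g \<tau>) Z (coord \<tau> Z t *v c) | c. True}"
proof -
  have inv: "matrix_inv (cA \<tau> Z t) ** cA \<tau> Z t = mat 1" "cA \<tau> Z t ** matrix_inv (cA \<tau> Z t) = mat 1"
    using matrix_inv_inverse assms(2) by (auto simp: chart_dom_def)
  have "lincomb (f t) c = lincomb (f \<tau>) (cA \<tau> Z t *v c)
      + sheared_lincomb (f \<tau>) (g \<tau>) Z (coord \<tau> Z t *v (cA \<tau> Z t *v c))" for c
    unfolding lincomb_coords[OF assms(1), of t c Z] coord_def
    by (simp add: matrix_vector_mul_assoc matrix_mul_assoc[symmetric] inv)
  moreover have "lincomb (f \<tau>) c + sheared_lincomb (f \<tau>) (g \<tau>) Z (coord \<tau> Z t *v c)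
      = lincomb (f t) (matrix_inv (cA \<tau> Z t) *v c)" for c
    unfolding lincomb_coords[OF assms(1), of t _ Z] coord_def
    by (simp add: matrix_vector_mul_assoc matrix_mul_assoc[symmetric] inv)
  ultimately show ?thesis unfolding curve_def by blast
qed

lemma graph_map_curve:
  assumes "\<tau> \<in> I" "t \<in> chart_dom \<tau> Z"
  shows "graph_map (range (sheared_lincomb (f \<tau>) (g \<tau>) Z)) (curve t) (lincomb (f \<tau>) c)
           = sheared_lincomb (f \<tau>) (g \<tau>) Z (coord \<tau> Z t *v c)"
proof -
  interpret symplectic_frame \<omega> "f \<tau>" "g \<tau>" using frame assms by blast
  show ?thesis
    unfolding graph_map_def curve_in_chart[OF assms]
    by (rule the_equality) (auto simp: chart_pair_inj)
qed

lemma curve_transversal: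
  assumes "\<tau> \<in> I" "t \<in> chart_dom \<tau> Z"
  shows "curve t \<inter> range (sheared_lincomb (f \<tau>) (g \<tau>) Z) = {0}"
proof -
  interpret symplectic_frame \<omega> "f \<tau>" "g \<tau>" using frame assms by blast
  have "v = 0" if v: "v \<in> curve t" "v = chart Z y" for v y
  proof -
    obtain c where "v = lincomb (f \<tau>) c + chart Z (coord \<tau> Z t *v c)"
      using v(1) unfolding curve_in_chart[OF assms] by blast
    then have "lincomb (f \<tau>) c + chart Z (coord \<tau> Z t *v c) = lincomb (f \<tau>) 0 + chart Z y"
      using v(2) by simp
    then have "c = 0" "y = coord \<tau> Z t *v c" unfolding chart_pair_inj by auto
    then show ?thesis using v by (simp add: linear_0[OF linear_chart])
  qed
  moreover have "0 \<in> curve t" unfolding curve_def by (metis lincomb_0 rangeI)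
  moreover have "0 \<in> range (chart Z)" using linear_0[OF linear_chart, of Z] by (metis rangeI)
  ultimately show ?thesis by blast
qed

lemma lagrangian_curve: "t \<in> I \<Longrightarrow> lagrangian \<omega> (curve t)"
  unfolding curve_def using frame symplectic_frame.lagrangian_e by blast

lemma bounded_linear_chart_apply:
  assumes "\<tau> \<in> I"
  shows "bounded_linear (\<lambda>M. sheared_lincomb (f \<tau>) (g \<tau>) Z (M *v c))"
proof -
  interpret symplectic_frame \<omega> "f \<tau>" "g \<tau>" using frame assms by blast
  show ?thesis
    using bounded_linear_compose[OF linear_conv_bounded_linear[THEN iffD1, OF linear_chart]
        bounded_bilinear.bounded_linear_left[OF bounded_bilinear_matrix_vector_mult]] .
qed

lemma smooth_lagrangian: "smooth_lagrangian_curve \<omega> I curve"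
  unfolding smooth_lagrangian_curve_def
proof (intro conjI ballI lagrangian_curve)
  fix \<tau> assume \<tau>: "\<tau> \<in> I"
  interpret symplectic_frame \<omega> "f \<tau>" "g \<tau>" using frame \<tau> by blast
  let ?J = "chart_dom \<tau> 0" and ?D = "range (lincomb (g \<tau>))"
  have "smooth_curve_on ?J (\<lambda>t. graph_map ?D (curve t) v)" if vc: "v \<in> curve \<tau>" for v
  proof -
    obtain c where v: "v = lincomb (f \<tau>) c" using vc unfolding curve_def by blast
    have "smooth_curve_on ?J (\<lambda>t. chart 0 (coord \<tau> 0 t *v c))"
      using smooth_coord[of \<tau> 0] bounded_linear_chart_apply[OF \<tau>, of 0 c]
      unfolding smooth_curve_on_iff_Ck_on[OF open_chart_dom]
      by (intro allI Ck_on_bounded_linear[of "\<lambda>M. chart 0 (M *v c)"]) auto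
    then show ?thesis
      by (rule smooth_curve_on_cong[OF open_chart_dom, rotated])
         (simp add: v graph_map_curve[OF \<tau>, of _ 0 c, simplified])
  qed
  then show "\<exists>D J. lagrangian \<omega> D \<and> open J \<and> \<tau> \<in> J \<and> J \<subseteq> I \<and> (\<forall>t\<in>J. curve t \<in> transversals \<omega> D) \<and>
      (\<forall>v\<in>curve \<tau>. smooth_curve_on J (\<lambda>t. graph_map D (curve t) v))"
    using lagrangian_e' open_chart_dom[of \<tau> 0] base_in_chart_dom[OF \<tau>, of 0] chart_dom_subset[of \<tau> 0]
      curve_transversal[OF \<tau>, of _ 0] lagrangian_curve
    by (intro exI[of _ ?D] exI[of _ ?J]) (auto simp: transversals_def)
qed

section \<open>Invariants of the curve: derivative subspace, curvature, velocity and arc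
  parameter\<close>

lemma affine_derivs:
  assumes \<tau>: "\<tau> \<in> I"
  shows "affine_deriv 1 (range (sheared_lincomb (f \<tau>) (g \<tau>) Z)) curve \<tau> (lincomb (f \<tau>) c)
           = sheared_lincomb (f \<tau>) (g \<tau>) Z c" (is ?th1)
    and "affine_deriv 2 (range (sheared_lincomb (f \<tau>) (g \<tau>) Z)) curve \<tau> (lincomb (f \<tau>) c)
           = sheared_lincomb (f \<tau>) (g \<tau>) Z (2 *\<^sub>R (Z *v c))" (is ?th2)
    and "affine_deriv 3 (range (lincomb (g \<tau>))) curve \<tau> (lincomb (f \<tau>) c)
           = lincomb (g \<tau>) (- 2 *\<^sub>R (K \<tau> *v c))" (is ?th3)
proof -
  interpret symplectic_frame \<omega> "f \<tau>" "g \<tau>" using frame \<tau> by blast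
  define L where "L = (\<lambda>Z t. matrix_inv (cA \<tau> Z t))"
  define N where "N = (\<lambda>Z t. cQ \<tau> t - cB \<tau> t ** L Z t ** cP \<tau> Z t)"
  define T where "T = (\<lambda>Z M. chart Z (M *v c))"
  have T: "bounded_linear (T Z)" for Z unfolding T_def by (rule bounded_linear_chart_apply[OF \<tau>])
  have d1: "(coord \<tau> Z has_vector_derivative N Z t ** L Z t) (at t)"
    and d2: "((\<lambda>t. N Z t ** L Z t) has_vector_derivative - 2 *\<^sub>R (N Z t ** L Z t ** (cP \<tau> Z t ** L Z t))) (at t)"
    and d3: "((\<lambda>t. cP \<tau> Z t ** L Z t) has_vector_derivative
            (cA \<tau> Z t ** K t ** L Z t - cP \<tau> Z t ** L Z t ** (cP \<tau> Z t ** L Z t))) (at t)"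
    if "t \<in> chart_dom \<tau> Z" for Z t
    using that riccati_derivatives[where A = "cA \<tau> Z" and B = "cB \<tau>" and P = "cP \<tau> Z" and Q = "cQ \<tau>"
        and S = S and K = K and t = t, OF deriv_cA[of t \<tau> Z] deriv_cB[of t \<tau>] deriv_cP[of t \<tau> Z] deriv_cQ[of t \<tau>]]
    unfolding coord_def[abs_def] N_def L_def chart_dom_def by auto
  have L1: "L Z \<tau> = mat 1" and N1: "N Z \<tau> = mat 1" for Z
    using matrix_inv_eqI[of "mat 1" "mat 1 :: real^'n^'n"] by (auto simp: N_def L_def coords_at_base[OF \<tau>])
  note dT = bounded_linear.has_vector_derivative[OF T]
  note tau = base_in_chart_dom[OF \<tau>]
  \<comment> \<open>\<open>graph_map\<close> has its explicit value on an open neighbourhood of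
    \<open>\<tau>\<close>, so the formula may be differentiated any number of times.\<close>
  have a: "affine_deriv k (range (chart Z)) curve \<tau> (lincomb (f \<tau>) c) = nth_vderiv k (\<lambda>t. T Z (coord \<tau> Z t)) \<tau>" for k Z
    unfolding affine_deriv_def T_def
    by (rule nth_vderiv_cong_open[OF open_chart_dom tau graph_map_curve[OF \<tau>]])
  have s1: "nth_vderiv (Suc k) (\<lambda>t. T Z (coord \<tau> Z t)) \<tau> = nth_vderiv k (\<lambda>t. T Z (N Z t ** L Z t)) \<tau>" for k Z
    by (rule nth_vderiv_Suc_open[OF open_chart_dom tau dT[OF d1]])
  have s2: "nth_vderiv (Suc k) (\<lambda>t. T Z (N Z t ** L Z t)) \<tau>
      = nth_vderiv k (\<lambda>t. T Z (- 2 *\<^sub>R (N Z t ** L Z t ** (cP \<tau> Z t ** L Z t)))) \<tau>" for k Z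
    by (rule nth_vderiv_Suc_open[OF open_chart_dom tau dT[OF d2]])
  show ?th1
    unfolding a One_nat_def s1 by (simp add: L1 N1 T_def)
  show ?th2
    unfolding a numeral_2_eq_2 s1 s2
    by (simp add: L1 N1 T_def coords_at_base[OF \<tau>] mm.minus_right scaleR_matrix_vector_assoc)
  \<comment> \<open>Product rule for the factors \<open>N L\<close> and \<open>P L\<close>. For
    \<open>Z = 0\<close> the matrix \<open>cP\<close> vanishes at \<open>\<tau>\<close>, so only the
    derivative of \<open>P L\<close> survives, and it contributes \<open>K \<tau>\<close>.\<close>
  have "((\<lambda>t. T 0 (- 2 *\<^sub>R (N 0 t ** L 0 t ** (cP \<tau> 0 t ** L 0 t)))) has_vector_derivative
      T 0 (- 2 *\<^sub>R (N 0 \<tau> ** L 0 \<tau> ** (cA \<tau> 0 \<tau> ** K \<tau> ** L 0 \<tau> - cP \<tau> 0 \<tau> ** L 0 \<tau> ** (cP \<tau> 0 \<tau> ** L 0 \<tau>))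
       + (- 2 *\<^sub>R (N 0 \<tau> ** L 0 \<tau> ** (cP \<tau> 0 \<tau> ** L 0 \<tau>))) ** (cP \<tau> 0 \<tau> ** L 0 \<tau>)))) (at \<tau>)"
    by (intro dT bounded_linear.has_vector_derivative[OF bounded_linear_scaleR_right]
        mm.has_vector_derivative d2 d3 tau)
  then have "((\<lambda>t. T 0 (- 2 *\<^sub>R (N 0 t ** L 0 t ** (cP \<tau> 0 t ** L 0 t)))) has_vector_derivative
      lincomb (g \<tau>) (- 2 *\<^sub>R (K \<tau> *v c))) (at \<tau>)"
    by (simp add: L1 N1 T_def coords_at_base[OF \<tau>] scaleR_matrix_vector_assoc)
  then have "vector_derivative (\<lambda>t. T 0 (- 2 *\<^sub>R (N 0 t ** L 0 t ** (cP \<tau> 0 t ** L 0 t)))) (at \<tau>)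
      = lincomb (g \<tau>) (- 2 *\<^sub>R (K \<tau> *v c))"
    by (rule vector_derivative_at)
  then show ?th3
    unfolding a[where Z = 0, unfolded chart_0] numeral_3_eq_3 s1 s2 unfolding nth_vderiv_Suc nth_vderiv_0 .
qed

text \<open>Every competitor is the range of some \<open>chart Z\<close>, where the second
  derivative is \<open>2 Z\<close> in coordinates; its vanishing forces
  \<open>Z = 0\<close>.\<close>

lemma derivative_curve_eq:
  assumes \<tau>: "\<tau> \<in> I"
  shows "derivative_curve \<omega> curve \<tau> = range (lincomb (g \<tau>))"
  unfolding derivative_curve_def
proof (rule the_equality)
  interpret symplectic_frame \<omega> "f \<tau>" "g \<tau>" using frame \<tau> by blast
  have "affine_deriv 2 (range (lincomb (g \<tau>))) curve \<tau> v = 0" if "v \<in> curve \<tau>" for v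
    using that affine_derivs(2)[OF \<tau>, of 0] by (auto simp: curve_def)
  then show "range (lincomb (g \<tau>)) \<in> transversals \<omega> (curve \<tau>) \<and>
      (\<forall>v\<in>curve \<tau>. affine_deriv 2 (range (lincomb (g \<tau>))) curve \<tau> v = 0)"
    using curve_transversal[OF \<tau> base_in_chart_dom[OF \<tau>, of 0]] lagrangian_e'
    by (auto simp: transversals_def Int_commute)
  fix D assume D: "D \<in> transversals \<omega> (curve \<tau>) \<and> (\<forall>v\<in>curve \<tau>. affine_deriv 2 D curve \<tau> v = 0)"
  then obtain Z where Z: "D = range (chart Z)"
    using transversal_is_chart unfolding curve_def by blast
  have "Z *v c = 0" for c
  proof -
    have "lincomb (f \<tau>) 0 + chart Z (2 *\<^sub>R (Z *v c)) = lincomb (f \<tau>) 0 + chart Z 0"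
      using D affine_derivs(2)[OF \<tau>, of Z c] linear_0[OF linear_chart, of Z] unfolding Z
      by (simp add: curve_def)
    then show ?thesis unfolding chart_pair_inj by simp
  qed
  then have "Z = 0" by (simp add: matrix_eq)
  then show "D = range (lincomb (g \<tau>))" using Z by simp
qed

lemma ricci_eq:
  assumes \<tau>: "\<tau> \<in> I"
  shows "ricci \<omega> curve \<tau> (lincomb (f \<tau>) c) = lincomb (f \<tau>) (- 2 *\<^sub>R (K \<tau> *v c))"
proof -
  interpret symplectic_frame \<omega> "f \<tau>" "g \<tau>" using frame \<tau> by blast
  have d1: "affine_deriv 1 (range (lincomb (g \<tau>))) curve \<tau> (lincomb (f \<tau>) c) = lincomb (g \<tau>) c" for c
    using affine_derivs(1)[OF \<tau>, of 0] by simp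
  \<comment> \<open>Injectivity makes \<open>inv_into\<close> a genuine inverse. The first
    derivative is the identity in coordinates, so inverting it moves the coordinates of the third
    derivative from \<open>g \<tau>\<close> back to \<open>f \<tau>\<close>.\<close>
  have "inj_on (affine_deriv 1 (range (lincomb (g \<tau>))) curve \<tau>) (curve \<tau>)"
    by (auto simp: inj_on_def curve_def d1[simplified] e'_inj)
  then show ?thesis
    unfolding ricci_def Let_def derivative_curve_eq[OF \<tau>] affine_derivs(3)[OF \<tau>]
    by (rule inv_into_f_eq) (simp_all only: d1 curve_def rangeI)
qed

lemma smooth_lincomb: "smooth_curve_on I (\<lambda>t. lincomb (f t) c)"
  unfolding smooth_curve_on_iff_Ck_on[OF I] lincomb_def
  by (intro allI Ck_on_sum Ck_on_bounded_linear[OF bounded_linear_scaleR_right] smooth_imp_Ck_on[OF I smooth_f])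

text \<open>Differentiating \<open>\<omega> (v t) (w t) = 0\<close> shows that the velocity form does not depend on the
  chosen curve.\<close>

lemma velocity_form_eq:
  assumes \<tau>: "\<tau> \<in> I"
  shows "velocity_form \<omega> I curve \<tau> (lincomb (f \<tau>) c) = c \<bullet> c"
proof -
  interpret symplectic_frame \<omega> "f \<tau>" "g \<tau>" using frame \<tau> by blast
  let ?v0 = "lincomb (f \<tau>) c" and ?w = "\<lambda>t. lincomb (f t) c"
  let ?w' = "\<Sum>j\<in>UNIV. c $ j *\<^sub>R (lincomb (f \<tau>) (column j (S \<tau>)) + g \<tau> j)"
  have w': "(?w has_vector_derivative ?w') (at \<tau>)"
    unfolding lincomb_def[of "f t" c for t]
    by (intro has_vector_derivative_sum bounded_linear.has_vector_derivative[OF bounded_linear_scaleR_right] f' \<tau>)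
  \<comment> \<open>The part with \<open>S\<close> stays in the Lagrangian span of
    \<open>f \<tau>\<close> and pairs to 0, while \<open>g \<tau> j\<close> reads off the
    coefficient \<open>c $ j\<close>.\<close>
  have "\<omega> ?v0 (lincomb (f \<tau>) (column j (S \<tau>)) + g \<tau> j) = c $ j" for j
    using coord_e[of c 0 j] by (simp add: bb.add_right omega_lincomb_left omega_lincomb_right ee)
  then have q: "\<omega> ?v0 ?w' = c \<bullet> c"
    by (simp add: bb.sum_right bb.scaleR_right inner_vec_def)
  show ?thesis
    unfolding velocity_form_def
  proof (rule the_equality)
    show "\<exists>v. smooth_curve_on I v \<and> (\<forall>t\<in>I. v t \<in> curve t) \<and> v \<tau> = ?v0 \<and>
        c \<bullet> c = \<omega> ?v0 (vector_derivative v (at \<tau>))"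
      using smooth_lincomb q vector_derivative_at[OF w']
      by (intro exI[of _ ?w]) (simp add: curve_def)
    fix r assume "\<exists>v. smooth_curve_on I v \<and> (\<forall>t\<in>I. v t \<in> curve t) \<and> v \<tau> = ?v0 \<and>
        r = \<omega> ?v0 (vector_derivative v (at \<tau>))"
    then obtain v where v: "smooth_curve_on I v" "\<And>t. t \<in> I \<Longrightarrow> v t \<in> curve t" "v \<tau> = ?v0"
      and r: "r = \<omega> ?v0 (vector_derivative v (at \<tau>))" by blast
    have v': "(v has_vector_derivative vector_derivative v (at \<tau>)) (at \<tau>)"
      using v(1) \<tau> unfolding smooth_curve_on_def by (metis nth_vderiv_0 vector_derivative_works)
    have "((\<lambda>t. \<omega> (v t) (?w t)) has_vector_derivative
        \<omega> (v \<tau>) ?w' + \<omega> (vector_derivative v (at \<tau>)) (?w \<tau>)) (at \<tau>)"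
      by (rule bb.has_vector_derivative[OF v' w'])
    moreover have "((\<lambda>t. \<omega> (v t) (?w t)) has_vector_derivative 0) (at \<tau>)"
    proof (rule has_vector_derivative_transform_within_open[OF has_vector_derivative_const I \<tau>])
      fix t assume "t \<in> I"
      then have "v t \<in> curve t" "?w t \<in> curve t" using v(2) by (auto simp: curve_def)
      then show "0 = \<omega> (v t) (?w t)" using lagrangian_curve[OF \<open>t \<in> I\<close>] by (auto simp: lagrangian_def)
    qed
    ultimately have "\<omega> (v \<tau>) ?w' + \<omega> (vector_derivative v (at \<tau>)) (?w \<tau>) = 0"
      by (rule vector_derivative_unique_at)
    then show "r = c \<bullet> c"
      using q r v(3) skew[of ?v0 "vector_derivative v (at \<tau>)"] by simp
  qed
qed

lemma jacobi: "jacobi_curve \<omega> I curve"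
  unfolding jacobi_curve_def
proof (intro conjI ballI impI smooth_lagrangian)
  fix t v assume t: "t \<in> I" and v: "v \<in> curve t" "v \<noteq> 0"
  obtain c where c: "v = lincomb (f t) c" using v(1) unfolding curve_def by blast
  then have "c \<noteq> 0" using v(2) by auto
  then show "velocity_form \<omega> I curve t v > 0"
    by (simp add: c velocity_form_eq[OF t])
qed

lemma polar_velocity_form:
  assumes "\<tau> \<in> I"
  shows "polar_form (velocity_form \<omega> I curve \<tau>) (f \<tau> i) (f \<tau> j) = (if i = j then 1 else 0)"
proof -
  have "polar_form (velocity_form \<omega> I curve \<tau>) (lincomb (f \<tau>) c) (lincomb (f \<tau>) d) = c \<bullet> d" for c d
    unfolding polar_form_def lincomb_add[symmetric] velocity_form_eq[OF assms]
    by (simp add: inner_add_left inner_add_right inner_commute)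
  from this[of "axis i 1" "axis j 1"] show ?thesis by (simp add: inner_axis_axis)
qed

text \<open>Writing \<open>b\<close> through \<open>f \<tau>\<close> with an invertible matrix
  \<open>T\<close> makes \<open>R\<close> similar to \<open>- 2 *\<^sub>R K \<tau>\<close>, so trace
  and determinant can be read off a diagonal matrix.\<close>

lemma geometric_arc_det:
  fixes b :: "'n \<Rightarrow> 'a"
  assumes \<tau>: "\<tau> \<in> I" and diag: "\<And>i j. i \<noteq> j \<Longrightarrow> K \<tau> $ i $ j = 0"
    and prod: "(\<Prod>i\<in>UNIV. \<bar>K \<tau> $ i $ i - (\<Sum>j\<in>UNIV. K \<tau> $ j $ j) / real CARD('n)\<bar>) = 1"
    and b: "basis_of (curve \<tau>) b"
  defines "R \<equiv> matrix_wrt b (ricci \<omega> curve \<tau>)"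
  shows "\<bar>det ((1/2) *\<^sub>R (R - mat (trace R / real CARD('n))))\<bar> = 1"
proof -
  interpret symplectic_frame \<omega> "f \<tau>" "g \<tau>" using frame \<tau> by blast
  have b': "inj b" "independent (range b)" "span (range b) = curve \<tau>"
    using b by (auto simp: basis_of_def)
  have "\<exists>x. b j = lincomb (f \<tau>) x" for j
    using b'(3) span_base[of "b j" "range b"] unfolding curve_def by blast
  then obtain x where x: "\<And>j. b j = lincomb (f \<tau>) (x j)" by metis
  define T :: "real^'n^'n" where "T = (\<chi> i j. x j $ i)"
  have bT: "lincomb b c = lincomb (f \<tau>) (T *v c)" for c
  proof -
    have "lincomb b c = lincomb (f \<tau>) (\<Sum>j\<in>UNIV. c $ j *\<^sub>R x j)"
      by (simp add: lincomb_def[of b] x linear_sum[OF linear_lincomb] lincomb_scaleR)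
    also have "(\<Sum>j\<in>UNIV. c $ j *\<^sub>R x j) = T *v c"
      by (simp add: vec_eq_iff T_def matrix_vector_mult_def mult.commute)
    finally show ?thesis .
  qed
  have "inj ((*v) T)"
  proof (rule injI)
    fix c d assume "T *v c = T *v d"
    then have "lincomb b c = lincomb b d" by (simp add: bT)
    then show "c = d" using lincomb_eq_iff[OF b'(1,2)] by blast
  qed
  then have detT: "det T \<noteq> 0" using det_nz_iff_inj[OF matrix_vector_mul_linear, of T] by simp
  have rep: "lincomb b (column j R) = ricci \<omega> curve \<tau> (b j)" for j
  proof -
    have "ricci \<omega> curve \<tau> (b j) \<in> span (range b)"
      unfolding b'(3) x ricci_eq[OF \<tau>] curve_def by (rule rangeI)
    then have "(\<Sum>v\<in>range b. representation (range b) (ricci \<omega> curve \<tau> (b j)) v *\<^sub>R v) = ricci \<omega> curve \<tau> (b j)"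
      using b'(2) by (intro sum_representation_eq) auto
    then show ?thesis
      by (simp add: sum.reindex[OF b'(1)] lincomb_def column_def R_def matrix_wrt_def)
  qed
  have "T *v column j R = (- 2 *\<^sub>R K \<tau>) *v column j T" for j
  proof -
    have "lincomb (f \<tau>) (T *v column j R) = lincomb (f \<tau>) (- 2 *\<^sub>R (K \<tau> *v x j))"
      using rep[of j] unfolding bT x ricci_eq[OF \<tau>] .
    then have "T *v column j R = - 2 *\<^sub>R (K \<tau> *v x j)" unfolding e_inj .
    also have "x j = column j T" by (simp add: T_def column_def)
    finally show ?thesis by (simp only: scaleR_matrix_vector_assoc)
  qed
  then have "(T *v column j R) $ i = ((- 2 *\<^sub>R K \<tau>) *v column j T) $ i" for i j by simp
  then have TR: "T ** R = (- 2 *\<^sub>R K \<tau>) ** T"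
    by (simp add: vec_eq_iff matrix_matrix_mult_def matrix_vector_mult_def column_def)
  have "R = matrix_inv T ** ((- 2 *\<^sub>R K \<tau>) ** T)"
    unfolding TR[symmetric] by (simp add: matrix_mul_assoc matrix_inv_inverse detT)
  then have "trace R = trace (matrix_inv T ** ((- 2 *\<^sub>R K \<tau>) ** T))"
    by (rule arg_cong)
  also have "\<dots> = trace (((- 2 *\<^sub>R K \<tau>) ** T) ** matrix_inv T)"
    by (rule trace_mul_sym)
  also have "\<dots> = trace (- 2 *\<^sub>R K \<tau>)"
    by (simp add: matrix_mul_assoc[symmetric] matrix_inv_inverse detT)
  also have "\<dots> = - 2 * (\<Sum>j\<in>UNIV. K \<tau> $ j $ j)"
    by (simp add: trace_def sum_distrib_left)
  finally have tr: "trace R = - 2 * (\<Sum>j\<in>UNIV. K \<tau> $ j $ j)" .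
  let ?m = "mat (trace R / real CARD('n)) :: real^'n^'n"
  have m: "?m = (trace R / real CARD('n)) *\<^sub>R mat 1" by (simp add: mat_def vec_eq_iff)
  \<comment> \<open>Scalar matrices commute with \<open>T\<close>, so the intertwining relation
    survives the subtraction; taking determinants then lets \<open>det T\<close> cancel.\<close>
  have "T ** ((1/2) *\<^sub>R (R - ?m)) = ((1/2) *\<^sub>R (- 2 *\<^sub>R K \<tau> - ?m)) ** T"
    unfolding mm.scaleR_left mm.scaleR_right mm.diff_left mm.diff_right TR m by simp
  then have "det T * det ((1/2) *\<^sub>R (R - ?m)) = det ((1/2) *\<^sub>R (- 2 *\<^sub>R K \<tau> - ?m)) * det T"
    by (metis det_mul)
  then have "det ((1/2) *\<^sub>R (R - ?m)) = det ((1/2) *\<^sub>R (- 2 *\<^sub>R K \<tau> - ?m))"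
    using detT by simp
  also have "\<dots> = (\<Prod>i\<in>UNIV. ((1/2) *\<^sub>R (- 2 *\<^sub>R K \<tau> - ?m)) $ i $ i)"
    by (rule det_diagonal) (simp add: diag mat_def)
  \<comment> \<open>The factor 1/2 cancels the 2 of the curvature, in the entries and in the trace
    alike. The remaining signs disappear under the absolute value.\<close>
  also have "\<dots> = (\<Prod>i\<in>UNIV. - (K \<tau> $ i $ i - (\<Sum>j\<in>UNIV. K \<tau> $ j $ j) / real CARD('n)))"
    by (rule prod.cong) (auto simp: mat_def tr field_simps)
  finally show ?thesis using prod by (simp only: abs_prod abs_minus_cancel)
qed

end

subsection \<open>Reconstruction from the Cartan matrix\<close>

text \<open>A basis, as a row of vectors, times a matrix. Packing the row into \<open>'a^'m\<close>,
  a Euclidean space, lets the theory of linear equations treat a whole frame as one unknown.\<close>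

definition frame_mult :: "'a::euclidean_space^'m \<Rightarrow> real^'m^'m \<Rightarrow> 'a^'m" where
  "frame_mult X C = (\<chi> j. \<Sum>i\<in>UNIV. (C $ i $ j) *\<^sub>R X $ i)"

lemma bounded_bilinear_frame_mult: "bounded_bilinear (frame_mult :: 'a::euclidean_space^'m \<Rightarrow> _)"
  unfolding bilinear_conv_bounded_bilinear[symmetric] bilinear_def
  by (auto intro!: linearI simp: frame_mult_def vec_eq_iff algebra_simps sum.distrib scaleR_right.sum)

lemma frame_cartan_matrix_iff:
  "frame_cartan_matrix I F C \<longleftrightarrow>
     (\<forall>t\<in>I. ((\<lambda>t. \<chi> j. F t j) has_vector_derivative frame_mult (\<chi> j. F t j) (C t)) (at t))"
    (is "_ \<longleftrightarrow> ?R")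
proof
  assume *: "frame_cartan_matrix I F C"
  then show ?R
    unfolding frame_cartan_matrix_def frame_mult_def by (auto intro!: has_vector_derivative_vec)
next
  assume *: ?R
  show "frame_cartan_matrix I F C"
    unfolding frame_cartan_matrix_def
  proof (intro ballI allI)
    fix t j assume t: "t \<in> I"
    have "((\<lambda>t. (\<chi> j. F t j) $ j) has_vector_derivative frame_mult (\<chi> j. F t j) (C t) $ j) (at t)"
      using * t by (intro bounded_linear.has_vector_derivative[OF bounded_linear_vec_nth]) auto
    then show "((\<lambda>t. F t j) has_vector_derivative (\<Sum>i\<in>UNIV. (C t $ i $ j) *\<^sub>R F t i)) (at t)"
      by (simp add: frame_mult_def)
  qed
qed

lemma smooth_block_matrix:
  fixes S K :: "real \<Rightarrow> real^'n^'n"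
  assumes I: "open I" and S: "smooth_curve_on I S" and K: "smooth_curve_on I K"
  shows "smooth_curve_on I (\<lambda>t. block_matrix (S t) (K t) (mat 1) (S t))"
  unfolding smooth_curve_on_iff_Ck_on[OF I]
proof (intro allI Ck_on_vec)
  fix k i j
  have e: "Ck_on k I (\<lambda>t. M t $ a $ b)" if "smooth_curve_on I M" for M :: "real \<Rightarrow> real^'n^'n" and a b
    using smooth_imp_Ck_on[OF I that]
    by (intro Ck_on_bounded_linear[OF bounded_linear_vec_nth])
  show "Ck_on k I (\<lambda>t. block_matrix (S t) (K t) (mat 1) (S t) $ i $ j)"
    by (cases i; cases j) (simp_all add: block_matrix_def e[OF S] e[OF K] Ck_on_const)
qed

section \<open>Preservation of the symplectic relations along the frame\<close>

lemma bounded_bilinear_congruence_action: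
  "bounded_bilinear (\<lambda>X C :: real^'m^'m. transpose C ** X + X ** C)"
proof -
  have tr: "transpose (A + B) = transpose A + transpose B" "transpose (r *\<^sub>R A) = r *\<^sub>R transpose A"
    for A B :: "real^'m^'m" and r
    by (simp_all add: transpose_def vec_eq_iff)
  show ?thesis
    unfolding bilinear_conv_bounded_bilinear[symmetric] bilinear_def
    by (auto intro!: linearI simp: tr mm.add_left mm.add_right mm.scaleR_left mm.scaleR_right algebra_simps)
qed

context symplectic_space
begin

text \<open>In blocks, the two mixed entries are \<open>S\<close> plus its transpose up to sign, the
  lower right entry is the transpose of \<open>K\<close> minus \<open>K\<close>, and the two
  identity blocks cancel in the upper left.\<close>

lemma cartan_block_matrix_symplectic:
  fixes F0 :: "'n::finite + 'n \<Rightarrow> 'a" and S K :: "real^'n^'n"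
  assumes F0: "symplectic_basis \<omega> F0" and S: "transpose S = - S" and K: "\<And>i j. i \<noteq> j \<Longrightarrow> K $ i $ j = 0"
  defines "C \<equiv> block_matrix S K (mat 1) S" and "W \<equiv> \<chi> i j. \<omega> (F0 i) (F0 j)"
  shows "transpose C ** W + W ** C = 0"
proof -
  have W: "\<omega> (F0 (Inl a)) (F0 (Inl b)) = 0" "\<omega> (F0 (Inr a)) (F0 (Inr b)) = 0"
     "\<omega> (F0 (Inl a)) (F0 (Inr b)) = (if a = b then 1 else 0)"
     "\<omega> (F0 (Inr a)) (F0 (Inl b)) = (if a = b then - 1 else 0)" for a b
    using F0 skew[of "F0 (Inr a)" "F0 (Inl b)"] by (auto simp: symplectic_basis_def)
  have Ssk: "S $ a $ b = - S $ b $ a" for a b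
    using arg_cong[OF S, of "\<lambda>M. M $ b $ a"] by (simp add: transpose_def)
  have Ksym: "K $ a $ b = K $ b $ a" for a b using K by (cases "a = b") auto
  have "(\<Sum>k\<in>UNIV. C $ k $ i * \<omega> (F0 k) (F0 j)) + (\<Sum>k\<in>UNIV. \<omega> (F0 i) (F0 k) * C $ k $ j) = 0" for i j
  proof -
    note simps = C_def block_matrix_def sum_UNIV_sum W mat_def if_distrib[of "\<lambda>x. _ * x"]
      if_distrib[of "\<lambda>x. x * _"]
    show ?thesis
    proof (cases i; cases j)
      fix a b assume "i = Inl a" "j = Inl b"
      then show ?thesis by (simp add: simps cong: if_cong)
    next
      fix a b assume "i = Inl a" "j = Inr b"
      then show ?thesis using Ssk[of a b] by (simp add: simps cong: if_cong)
    next
      fix a b assume "i = Inr a" "j = Inl b"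
      then show ?thesis using Ssk[of a b] by (simp add: simps cong: if_cong)
    next
      fix a b assume "i = Inr a" "j = Inr b"
      then show ?thesis using Ksym[of a b] by (simp add: simps cong: if_cong)
    qed
  qed
  then show ?thesis
    by (simp add: vec_eq_iff matrix_matrix_mult_def transpose_def W_def)
qed

text \<open>The Gram matrix \<open>W\<close> of the frame satisfies the linear equation
  \<open>W' = transpose C ** W + W ** C\<close>. The initial value is a stationary solution by
  hypothesis, so the difference solves the same equation from 0.\<close>

lemma gram_matrix_constant:
  fixes F :: "real \<Rightarrow> 'm::finite \<Rightarrow> 'a" and C :: "real \<Rightarrow> real^'m^'m"
  assumes I: "is_interval I" "0 \<in> I" and C: "continuous_on I C" and F: "frame_cartan_matrix I F C"
    and W: "\<And>t. t \<in> I \<Longrightarrow> transpose (C t) ** (\<chi> i j. \<omega> (F 0 i) (F 0 j)) + (\<chi> i j. \<omega> (F 0 i) (F 0 j)) ** C t = 0"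
    and t: "t \<in> I"
  shows "\<omega> (F t i) (F t j) = \<omega> (F 0 i) (F 0 j)"
proof -
  let ?W = "\<lambda>t. \<chi> i j. \<omega> (F t i) (F t j)"
  have W': "(?W has_vector_derivative transpose (C t) ** ?W t + ?W t ** C t) (at t)" if t: "t \<in> I" for t
  proof (intro has_vector_derivative_vec)
    fix i j
    have F': "((\<lambda>t. F t j) has_vector_derivative (\<Sum>i\<in>UNIV. (C t $ i $ j) *\<^sub>R F t i)) (at t)" for j
      using F t by (simp add: frame_cartan_matrix_def)
    have "((\<lambda>t. \<omega> (F t i) (F t j)) has_vector_derivative
        (transpose (C t) ** ?W t + ?W t ** C t) $ i $ j) (at t)"
      by (rule has_vector_derivative_eq_rhs[OF bb.has_vector_derivative[OF F' F']])
         (simp add: bb.sum_left bb.sum_right bb.scaleR_left bb.scaleR_right matrix_matrix_mult_def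
           transpose_def mult.commute)
    then show "((\<lambda>t. ?W t $ i $ j) has_vector_derivative
        (transpose (C t) ** ?W t + ?W t ** C t) $ i $ j) (at t)" by simp
  qed
  have "?W t - ?W 0 = 0"
  proof (rule linear_ode_unique_zero[OF bounded_bilinear_congruence_action I C _ _ t])
    fix t assume "t \<in> I"
    have "transpose (C t) ** (?W t - ?W 0) + (?W t - ?W 0) ** C t
        = transpose (C t) ** ?W t + ?W t ** C t - (transpose (C t) ** ?W 0 + ?W 0 ** C t)"
      by (simp add: mm.diff_left mm.diff_right)
    also have "\<dots> = transpose (C t) ** ?W t + ?W t ** C t - 0"
      unfolding W[OF \<open>t \<in> I\<close>] by simp
    finally show "((\<lambda>t. ?W t - ?W 0) has_vector_derivative
        transpose (C t) ** (?W t - ?W 0) + (?W t - ?W 0) ** C t) (at t)"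
      using has_vector_derivative_diff[OF W'[OF \<open>t \<in> I\<close>] has_vector_derivative_const[of "?W 0"]] by simp
  qed simp
  then show ?thesis by (simp add: vec_eq_iff)
qed

end

theorem theorem3:
  fixes \<omega> :: "'a::euclidean_space \<Rightarrow> 'a \<Rightarrow> real"
    and I :: "real set"
    and S K :: "real \<Rightarrow> real^'n^'n"
    and F0 :: "'n::finite + 'n \<Rightarrow> 'a"
  assumes "symplectic_form \<omega>"
    and "DIM('a) = 2 * CARD('n)"
    and "open I" "is_interval I" "0 \<in> I"
    and "smooth_curve_on I S" "smooth_curve_on I K"
    and "\<And>\<tau>. \<tau> \<in> I \<Longrightarrow> transpose (S \<tau>) = - S \<tau>"
    and "\<And>\<tau> i j. \<tau> \<in> I \<Longrightarrow> i \<noteq> j \<Longrightarrow> K \<tau> $ i $ j = 0"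
    and "\<And>\<tau>. \<tau> \<in> I \<Longrightarrow>
           (\<Prod>i\<in>UNIV. \<bar>K \<tau> $ i $ i - (\<Sum>j\<in>UNIV. K \<tau> $ j $ j) / real CARD('n)\<bar>) = 1"
    and "symplectic_basis \<omega> F0"
  shows "\<exists>\<Gamma>.
      (jacobi_curve \<omega> I \<Gamma> \<and> \<Gamma> 0 = span (range (\<lambda>i. F0 (Inl i))) \<and>
       has_cartan_matrix \<omega> I F0 \<Gamma> (\<lambda>\<tau>. block_matrix (S \<tau>) (K \<tau>) (mat 1) (S \<tau>))) \<and>
      (\<forall>\<Gamma>'. jacobi_curve \<omega> I \<Gamma>' \<and> \<Gamma>' 0 = span (range (\<lambda>i. F0 (Inl i))) \<and>
       has_cartan_matrix \<omega> I F0 \<Gamma>' (\<lambda>\<tau>. block_matrix (S \<tau>) (K \<tau>) (mat 1) (S \<tau>))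
         \<longrightarrow> (\<forall>\<tau>\<in>I. \<Gamma>' \<tau> = \<Gamma> \<tau>))"
proof -
  interpret symplectic_space \<omega> by unfold_locales (rule assms(1))
  let ?C = "\<lambda>\<tau>. block_matrix (S \<tau>) (K \<tau>) (mat 1) (S \<tau>)"
  have smC: "smooth_curve_on I ?C" by (rule smooth_block_matrix[OF assms(3,6,7)])
  then have C: "continuous_on I ?C" by (rule smooth_imp_continuous_on)
  obtain X where X0: "X 0 = (\<chi> j. F0 j)"
    and X': "\<And>t. t \<in> I \<Longrightarrow> (X has_vector_derivative frame_mult (X t) (?C t)) (at t)"
    using linear_ode_exists[OF bounded_bilinear_frame_mult assms(3-5) C] by blast
  have smX: "smooth_curve_on I X"
    by (rule smooth_linear_ode[OF bounded_bilinear_frame_mult assms(3) smC X'])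
  define F where "F = (\<lambda>t j. X t $ j)"
  have F0: "F 0 = F0" by (simp add: F_def X0 fun_eq_iff)
  have F': "frame_cartan_matrix I F ?C"
    unfolding frame_cartan_matrix_iff F_def using X' by simp
  have smF: "smooth_curve_on I (\<lambda>t. F t j)" for j
    using smX unfolding smooth_curve_on_iff_Ck_on[OF assms(3)] F_def
    by (blast intro: Ck_on_bounded_linear[OF bounded_linear_vec_nth])
  \<comment> \<open>The pairings keep their initial values, so the solution remains a symplectic
    frame on all of \<open>I\<close>.\<close>
  have gram: "\<omega> (F t i) (F t j) = \<omega> (F0 i) (F0 j)" if "t \<in> I" for t i j
    using gram_matrix_constant[OF assms(4,5) C F' _ that, unfolded F0]
      cartan_block_matrix_symplectic[OF assms(11) assms(8) assms(9)] by simp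
  have fr: "symplectic_frame \<omega> (\<lambda>i. F t (Inl i)) (\<lambda>i. F t (Inr i))" if "t \<in> I" for t
    using assms(2,11) gram[OF that] by unfold_locales (auto simp: symplectic_basis_def)
  interpret mf: moving_frame \<omega> I S K "\<lambda>t i. F t (Inl i)" "\<lambda>t i. F t (Inr i)"
  proof (intro moving_frame.intro moving_frame_axioms.intro)
    fix t j assume t: "t \<in> I"
    have d: "((\<lambda>t. F t k) has_vector_derivative (\<Sum>i\<in>UNIV. (?C t $ i $ k) *\<^sub>R F t i)) (at t)" for k
      using F' t by (simp add: frame_cartan_matrix_def)
    show "((\<lambda>t. F t (Inl j)) has_vector_derivative
        lincomb (\<lambda>i. F t (Inl i)) (column j (S t)) + F t (Inr j)) (at t)"
      by (rule has_vector_derivative_eq_rhs[OF d])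
         (simp add: sum_UNIV_sum block_matrix_def lincomb_def column_def mat_def
           if_distrib[of "\<lambda>x. x *\<^sub>R _"] cong: if_cong)
    show "((\<lambda>t. F t (Inr j)) has_vector_derivative
        lincomb (\<lambda>i. F t (Inl i)) (column j (K t)) + lincomb (\<lambda>i. F t (Inr i)) (column j (S t))) (at t)"
      by (rule has_vector_derivative_eq_rhs[OF d])
         (simp add: sum_UNIV_sum block_matrix_def lincomb_def column_def)
  qed (use assms(3) smF fr symplectic_space_axioms in auto)
  let ?G = mf.curve
  have G: "?G t = span (range (\<lambda>i. F t (Inl i)))" for t
    by (simp add: mf.curve_def range_lincomb)
  have "geometric_arc TYPE('n) \<omega> I ?G"
    unfolding geometric_arc_def Let_def
    by (intro ballI allI impI mf.geometric_arc_det) (use assms(9,10) in auto)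
  moreover have "frenet_frame \<omega> I ?G F"
    unfolding frenet_frame_def
  proof (intro conjI allI ballI smF)
    fix \<tau> i assume \<tau>: "\<tau> \<in> I"
    interpret symplectic_frame \<omega> "\<lambda>i. F \<tau> (Inl i)" "\<lambda>i. F \<tau> (Inr i)" using fr \<tau> .
    have "case_sum (\<lambda>i. F \<tau> (Inl i)) (\<lambda>i. F \<tau> (Inr i)) = F \<tau>"
      by (auto simp: fun_eq_iff split: sum.split)
    then show "symplectic_basis \<omega> (F \<tau>)" using symplectic_basis_case_sum by simp
    show "basis_of (?G \<tau>) (\<lambda>i. F \<tau> (Inl i))" unfolding mf.curve_def by (rule basis_e)
    show "basis_of (derivative_curve \<omega> ?G \<tau>) (\<lambda>i. F \<tau> (Inr i))"
      unfolding mf.derivative_curve_eq[OF \<tau>] by (rule basis_e')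
    \<comment> \<open>Diagonality of \<open>K\<close> is what makes the frame vectors eigenvectors
      of the curvature.\<close>
    have "K \<tau> *v axis i 1 = K \<tau> $ i $ i *\<^sub>R axis i 1"
      using assms(9)[OF \<tau>] unfolding matrix_vector_mult_basis
      by (auto simp: column_def vec_eq_iff axis_def)
    then have "ricci \<omega> ?G \<tau> (F \<tau> (Inl i)) = (- 2 * K \<tau> $ i $ i) *\<^sub>R F \<tau> (Inl i)"
      using mf.ricci_eq[OF \<tau>, of "axis i 1"] lincomb_scaleR[of "\<lambda>i. F \<tau> (Inl i)" "- 2 * K \<tau> $ i $ i" "axis i 1"]
      by simp
    then show "\<exists>c. ricci \<omega> ?G \<tau> (F \<tau> (Inl i)) = c *\<^sub>R F \<tau> (Inl i)" by blast
  qed (rule mf.polar_velocity_form)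
  ultimately have cart: "has_cartan_matrix \<omega> I F0 ?G ?C"
    unfolding has_cartan_matrix_def using F0 F' by blast
  have uniq: "\<Gamma>' \<tau> = ?G \<tau>" if c': "has_cartan_matrix \<omega> I F0 \<Gamma>' ?C" and \<tau>: "\<tau> \<in> I" for \<Gamma>' \<tau>
  proof -
    obtain F2 where F2: "frenet_frame \<omega> I \<Gamma>' F2" "F2 0 = F0" "frame_cartan_matrix I F2 ?C"
      using c' unfolding has_cartan_matrix_def by blast
    \<comment> \<open>Both frames solve the same linear equation and agree at 0, so their difference
      vanishes; the subspaces then agree as spans of the same first halves.\<close>
    have "(\<chi> j. F2 \<tau> j) - X \<tau> = 0"
    proof (rule linear_ode_unique_zero[OF bounded_bilinear_frame_mult assms(4,5) C _ _ \<tau>])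
      fix t assume t: "t \<in> I"
      have "((\<lambda>t. \<chi> j. F2 t j) has_vector_derivative frame_mult (\<chi> j. F2 t j) (?C t)) (at t)"
        using F2(3) t unfolding frame_cartan_matrix_iff by blast
      from has_vector_derivative_diff[OF this X'[OF t]]
      show "((\<lambda>t. (\<chi> j. F2 t j) - X t) has_vector_derivative
          frame_mult ((\<chi> j. F2 t j) - X t) (?C t)) (at t)"
        by (simp add: bounded_bilinear.diff_left[OF bounded_bilinear_frame_mult])
    qed (simp add: X0 F2(2))
    then have "F2 \<tau> = F \<tau>" by (auto simp: F_def vec_eq_iff fun_eq_iff)
    moreover have "span (range (\<lambda>i. F2 \<tau> (Inl i))) = \<Gamma>' \<tau>"
      using F2(1) \<tau> unfolding frenet_frame_def basis_of_def by blast
    ultimately show ?thesis by (simp add: G)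
  qed
  show ?thesis
  proof (intro exI[of _ ?G] conjI allI impI ballI)
    show "?G 0 = span (range (\<lambda>i. F0 (Inl i)))" using G[of 0] unfolding F0 .
  qed (use mf.jacobi cart uniq in blast)+
qed

end
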